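(* Consider the network of $N$ interconnected uncertain subsystems described in the context, with block-diagonal transfer matrices $G_{pq},G_{pw},G_{zq},G_{zw}$, interconnection matrix $\Gamma$, uncertainty $\Delta=\operatorname{diag}(\Delta^1,\dots,\Delta^N)$, lumped matrix $\bar G = G_{pq}+G_{pw}(I-\Gamma G_{zw})^{-1}\Gamma G_{zq}$, and set $\mathcal P$ of admissible multipliers $\bar\Pi$. The following two feasibility statements are equivalent. (a) There exist $\bar\Pi=\begin{bmatrix}\bar\Pi_{11}&\bar\Pi_{12}\\ \bar\Pi_{21}&\bar\Pi_{22}\end{bmatrix}\in\mathcal P$, a positive definite matrix $X\succ 0$ of order $\bar m=\sum_{i=1}^N m_i$, and $\epsilon>0$ such that, for all $\omega\in[0,\infty]$ (all transfer matrices and multipliers being evaluated at $j\omega$), $$\begin{bmatrix} G_{pq} & G_{pw} \\ I & 0 \end{bmatrix}^{*}\begin{bmatrix} \bar{\Pi}_{11} & \bar{\Pi}_{12} \\ \bar{\Pi}_{21} & \bar{\Pi}_{22} \end{bmatrix}\begin{bmatrix} G_{pq} & G_{pw} \\ I & 0 \end{bmatrix} - \begin{bmatrix} -G_{zq}^{*}\Gamma^T\\ I-G_{zw}^{*}\Gamma^T \end{bmatrix}X\begin{bmatrix} -\Gamma G_{zq} & I-\Gamma G_{zw} \end{bmatrix} \preceq -\epsilon I .$$ (b) There exist $\bar\Pi\in\mathcal P$ and $\epsilon>0$ such that, for all $\omega\in[0,\infty]$, $$\begin{bmatrix}\bar G(j\omega)\\ I\end{bmatrix}^{*}\bar\Pi(j\omega)\begin{bmatrix}\bar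 G(j\omega)\\ I\end{bmatrix}\preceq -\epsilon I .$$
   Context: Notation: $\mathcal{RH}_\infty^{m\times n}$ is the set of $m\times n$ real rational transfer function matrices with no poles in the closed right half plane. $A\preceq B$ (resp. $A\prec B$) means $B-A$ is positive semidefinite (resp. definite). $(\cdot)^*$ is conjugate transpose. $\mathcal L_2$ is the set of square integrable signals on $[0,\infty)$; $\hat q$ denotes the Fourier transform. IQC: Let $\Pi$ be a bounded self-adjoint operator given by a bounded transfer function matrix with $\Pi(j\omega)=\Pi(j\omega)^*$. A bounded causal operator $\Delta$ (acting on $\mathbb R^d$-valued signals, with $\mathbb R^d$-valued outputs) satisfies the integral quadratic constraint defined by $\Pi$, written $\Delta\in\mathrm{IQC}(\Pi)$, if for all $q\in\mathcal L_2$ $$\int_{-\infty}^{\infty}\begin{bmatrix}\hat q(j\omega)\\ \widehat{\Delta(q)}(j\omega)\end{bmatrix}^*\Pi(j\omega)\begin{bmatrix}\hat q(j\omega)\\ \widehat{\Delta(q)}(j\omega)\end{bmatrix}d\omega\ge 0 .$$ Network: For $i=1,\dots,N$, subsystem $i$ is $p^i=G^i_{pq}q^i+G^i_{pw}w^i$, $z^i=G^i_{zq}q^i+G^i_{zw}w^i$, $q^i=\Delta^i(p^i)$, with $G^i_{pq}\in\mathcal{RH}_\infty^{d_i\times d_i}$, $G^i_{pw}\in\mathcal{RH}_\infty^{d_i\times m_i}$, $G^i_{zq}\in\mathcal{RH}_\infty^{l_i\times d_i}$, $G^i_{zw}\in\mathcal{RH}_\infty^{l_i\times m_i}$, and $\Delta^i$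 a bounded causal operator on $\mathbb R^{d_i}$-valued signals. The subsystems are interconnected by $w=\Gamma z$, where $w=(w^1,\dots,w^N)$, $z=(z^1,\dots,z^N)$ and $\Gamma=[\Gamma_{ij}]$ is a block matrix whose blocks $\Gamma_{ij}$ (of size $m_i\times l_j$) are 0-1 matrices. Put $G_{ab}=\operatorname{diag}(G_{ab}^1,\dots,G_{ab}^N)$ for $ab\in\{pq,pw,zq,zw\}$ and $\Delta=\operatorname{diag}(\Delta^1,\dots,\Delta^N)$. The full system is $p=G_{pq}q+G_{pw}w$, $z=G_{zq}q+G_{zw}w$, $q=\Delta(p)$, $w=\Gamma z$. Standing assumptions: $I-\Gamma G_{zw}(j\omega)$ has a bounded inverse for all frequencies (i.e. it is invertible for every $\omega\in[0,\infty]$ with uniformly bounded inverse), and for every $\tau\in[0,1]$ the interconnection with $\Delta$ replaced by $\tau\Delta$ is well-posed. Admissible multipliers: $\mathcal P$ is the set of all $\bar\Pi=\begin{bmatrix}\bar\Pi_{11}&\bar\Pi_{12}\\ \bar\Pi_{21}&\bar\Pi_{22}\end{bmatrix}$ with $\bar\Pi_{ab}=\operatorname{diag}(\Pi^1_{ab},\dots,\Pi^N_{ab})$, where $\Pi^i=\begin{bmatrix}\Pi^i_{11}&\Pi^i_{12}\\ \Pi^i_{21}&\Pi^i_{22}\end{bmatrix}$ are multipliers (bounded, Hermitian-valued on the imaginary axis, partitioned into $d_i\times d_i$ blocks) with $\Delta^i\in\mathrm{IQC}(\Pi^i)$ for $i=1,\dots,N$, and such that $\tau\Delta\in\mathrm{IQC}(\bar\Pi)$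 for all $\tau\in[0,1]$. *)

theory Defs
  imports
    "HOL-Analysis.Analysis"
    "HOL-Computational_Algebra.Computational_Algebra"
    "HOL-Computational_Algebra.Field_as_Ring"
    "Jordan_Normal_Form.Matrix"
    "Jordan_Normal_Form.Gauss_Jordan_Elimination"
    "Jordan_Normal_Form.Schur_Decomposition"
    "Jordan_Normal_Form.Jordan_Normal_Form"
begin

hide_const (open) Finite_Cartesian_Product.vec Finite_Cartesian_Product.mat
  Finite_Cartesian_Product.row Finite_Cartesian_Product.column
unbundle no vec_syntax

section \<open>Matrix inequalities\<close>

definition hermitian :: "complex mat \<Rightarrow> bool" where
  "hermitian A \<longleftrightarrow> square_mat A \<and> mat_adjoint A = A"

text \<open>Here \<open>(A *\<^sub>v v) \<bullet>c v\<close> is \<open>v\<^sup>* A v\<close>, a real number for Hermitian \<open>A\<close>.\<close>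

definition pos_semidef :: "complex mat \<Rightarrow> bool" where
  "pos_semidef A \<longleftrightarrow> hermitian A \<and>
     (\<forall>v \<in> carrier_vec (dim_row A). 0 \<le> Re ((A *\<^sub>v v) \<bullet>c v))"

definition pos_def :: "complex mat \<Rightarrow> bool" where
  "pos_def A \<longleftrightarrow> hermitian A \<and>
     (\<forall>v \<in> carrier_vec (dim_row A). v \<noteq> 0\<^sub>v (dim_row A) \<longrightarrow> 0 < Re ((A *\<^sub>v v) \<bullet>c v))"

definition loewner_le :: "nat \<Rightarrow> complex mat \<Rightarrow> complex mat \<Rightarrow> bool" where
  "loewner_le n A B \<longleftrightarrow>
     A \<in> carrier_mat n n \<and> B \<in> carrier_mat n n \<and> pos_semidef (B - A)"

text \<open>The inverse; only meaningful for invertible matrices.\<close>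

definition minv :: "complex mat \<Rightarrow> complex mat" where
  "minv A = the (mat_inverse A)"

definition cplx_mat :: "real mat \<Rightarrow> complex mat" where
  "cplx_mat = map_mat complex_of_real"

definition bdiag :: "nat \<Rightarrow> (nat \<Rightarrow> 'a::zero mat) \<Rightarrow> 'a mat" where
  "bdiag N A = diag_block_mat (map A [0..<N])"

text \<open>The \<open>n \<times> n\<close> block of a \<open>2n \<times> 2n\<close> matrix in block row \<open>a\<close> and block column \<open>b\<close>,
  where \<open>a, b \<in> {0, 1}\<close>.\<close>

definition blk :: "nat \<Rightarrow> nat \<Rightarrow> nat \<Rightarrow> 'a mat \<Rightarrow> 'a mat" where
  "blk n a b A = mat n n (\<lambda>(i, j). A $$ (a * n + i, b * n + j))"

section \<open>Transfer matrices and frequency responses\<close>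

type_synonym tfmat = "real poly fract mat"

definition ratfun_eval :: "real poly fract \<Rightarrow> complex \<Rightarrow> complex" where
  "ratfun_eval f s = (let (a, b) = quot_of_fract f in
     poly (map_poly complex_of_real a) s / poly (map_poly complex_of_real b) s)"

text \<open>\<open>quot_of_fract\<close> is in lowest terms, so the poles are the zeros of the denominator.
  The closed right half plane includes the point at infinity, i.e. the functions are proper.\<close>

definition stable_proper :: "real poly fract \<Rightarrow> bool" where
  "stable_proper f \<longleftrightarrow> (let (a, b) = quot_of_fract f in
     degree a \<le> degree b \<and>
     (\<forall>s::complex. 0 \<le> Re s \<longrightarrow> poly (map_poly complex_of_real b) s \<noteq> 0))"

definition RH_inf :: "nat \<Rightarrow> nat \<Rightarrow> tfmat set" where
  "RH_inf m n = {G \<in> carrier_mat m n. \<forall>f \<in> elements_mat G. stable_proper f}"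

definition freq_resp :: "tfmat \<Rightarrow> real \<Rightarrow> complex mat" where
  "freq_resp G w = map_mat (\<lambda>f. ratfun_eval f (\<i> * complex_of_real w)) G"

text \<open>A frequency response evaluated at \<open>j\<omega>\<close> for an extended frequency \<open>\<omega> \<in> [0, \<infinity>]\<close>;
  the value at \<open>\<infinity>\<close> is the entrywise limit.\<close>

definition at_freq :: "(real \<Rightarrow> complex mat) \<Rightarrow> ereal \<Rightarrow> complex mat" where
  "at_freq F \<omega> =
     (if \<omega> = \<infinity>
      then mat (dim_row (F 0)) (dim_col (F 0)) (\<lambda>(i, j). Lim at_top (\<lambda>w. F w $$ (i, j)))
      else F (real_of_ereal \<omega>))"

definition tf_at :: "tfmat \<Rightarrow> ereal \<Rightarrow> complex mat" where
  "tf_at G = at_freq (freq_resp G)"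

definition has_bounded_inverse :: "(ereal \<Rightarrow> complex mat) \<Rightarrow> bool" where
  "has_bounded_inverse F \<longleftrightarrow>
     (\<exists>c. \<forall>\<omega> \<in> {0..\<infinity>}. invertible_mat (F \<omega>) \<and> norm_bound (minv (F \<omega>)) c)"

definition lumped ::
  "tfmat \<Rightarrow> tfmat \<Rightarrow> tfmat \<Rightarrow> tfmat \<Rightarrow> real mat \<Rightarrow> ereal \<Rightarrow> complex mat" where
  "lumped Gpq Gpw Gzq Gzw \<Gamma> \<omega> =
     tf_at Gpq \<omega> + tf_at Gpw \<omega> *
       minv (1\<^sub>m (dim_row \<Gamma>) - cplx_mat \<Gamma> * tf_at Gzw \<omega>) * cplx_mat \<Gamma> * tf_at Gzq \<omega>"

section \<open>Signals and operators\<close>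

text \<open>Signals live on \<open>[0, \<infinity>)\<close>; values at negative times are ignored throughout, and signals
  are compared up to null sets.\<close>

type_synonym signal = "real \<Rightarrow> real vec"

definition energy :: "real set \<Rightarrow> signal \<Rightarrow> ennreal" where
  "energy S x = (\<integral>\<^sup>+ t. ennreal (x t \<bullet> x t) * indicator S t \<partial>lborel)"

definition L2e :: "nat \<Rightarrow> signal set" where
  "L2e n = {x. (\<forall>t\<ge>0. x t \<in> carrier_vec n) \<and>
     (\<forall>k<n. set_borel_measurable lborel {0..} (\<lambda>t. x t $ k)) \<and>
     (\<forall>T. energy {0..T} x < \<infinity>)}"

definition L2 :: "nat \<Rightarrow> signal set" where
  "L2 n = {x \<in> L2e n. energy {0..} x < \<infinity>}"

definition eq_upto :: "real \<Rightarrow> signal \<Rightarrow> signal \<Rightarrow> bool" where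
  "eq_upto T x y \<longleftrightarrow> (AE t in lborel. t \<in> {0..T} \<longrightarrow> x t = y t)"

definition eq_sig :: "signal \<Rightarrow> signal \<Rightarrow> bool" where
  "eq_sig x y \<longleftrightarrow> (AE t in lborel. 0 \<le> t \<longrightarrow> x t = y t)"

definition trunc :: "nat \<Rightarrow> real \<Rightarrow> signal \<Rightarrow> signal" where
  "trunc n T x = (\<lambda>t. if t \<le> T then x t else 0\<^sub>v n)"

text \<open>Causality includes that the operator respects equality almost everywhere.\<close>

definition bounded_causal :: "nat \<Rightarrow> (signal \<Rightarrow> signal) \<Rightarrow> bool" where
  "bounded_causal n D \<longleftrightarrow>
     (\<forall>x \<in> L2e n. D x \<in> L2e n) \<and>
     (\<forall>x \<in> L2e n. \<forall>y \<in> L2e n. \<forall>T. eq_upto T x y \<longrightarrow> eq_upto T (D x) (D y)) \<and>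
     (\<exists>c::real. \<forall>x \<in> L2 n. energy {0..} (D x) \<le> ennreal c * energy {0..} x)"

text \<open>The Fourier transform of a square integrable \<open>f\<close> on \<open>[0, \<infinity>)\<close> is the \<open>L\<^sup>2\<close>-limit of the
  transforms of its truncations to \<open>[0, T]\<close>; it exists and is unique up to null sets
  by Plancherel's theorem.\<close>

definition is_fourier :: "(real \<Rightarrow> real) \<Rightarrow> (real \<Rightarrow> complex) \<Rightarrow> bool" where
  "is_fourier f F \<longleftrightarrow> F \<in> borel_measurable lborel \<and>
     ((\<lambda>T. \<integral>\<^sup>+ w. ennreal ((cmod (F w -
         (LINT t:{0..T}|lborel. complex_of_real (f t) * exp (- (\<i> * complex_of_real (w * t))))))\<^sup>2)
       \<partial>lborel) \<longlongrightarrow> 0) at_top"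

definition fourier :: "nat \<Rightarrow> signal \<Rightarrow> real \<Rightarrow> complex vec" where
  "fourier n x w = vec n (\<lambda>k. (SOME F. is_fourier (\<lambda>t. x t $ k) F) w)"

section \<open>Integral quadratic constraints\<close>

text \<open>Existence of the limit gives a meaning to the value of a multiplier at infinite
  frequency, which enters the frequency-domain inequalities.\<close>

definition multiplier :: "nat \<Rightarrow> (real \<Rightarrow> complex mat) \<Rightarrow> bool" where
  "multiplier n \<Phi> \<longleftrightarrow>
     (\<forall>w. \<Phi> w \<in> carrier_mat (n + n) (n + n) \<and> hermitian (\<Phi> w)) \<and>
     (\<forall>i<n + n. \<forall>j<n + n. (\<lambda>w. \<Phi> w $$ (i, j)) \<in> borel_measurable lborel \<and>
        (\<exists>l. ((\<lambda>w. \<Phi> w $$ (i, j)) \<longlongrightarrow> l) at_top)) \<and>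
     (\<exists>c. \<forall>w. norm_bound (\<Phi> w) c)"

definition IQC :: "nat \<Rightarrow> (real \<Rightarrow> complex mat) \<Rightarrow> (signal \<Rightarrow> signal) set" where
  "IQC n \<Phi> = {D. bounded_causal n D \<and> (\<forall>q \<in> L2 n.
     0 \<le> (LINT w|lborel. (let v = fourier n q w @\<^sub>v fourier n (D q) w
                         in Re ((\<Phi> w *\<^sub>v v) \<bullet>c v))))}"

definition scale_op :: "real \<Rightarrow> (signal \<Rightarrow> signal) \<Rightarrow> signal \<Rightarrow> signal" where
  "scale_op \<tau> D x = (\<lambda>t. \<tau> \<cdot>\<^sub>v D x t)"

definition part :: "(nat \<Rightarrow> nat) \<Rightarrow> nat \<Rightarrow> signal \<Rightarrow> signal" where
  "part d i x = (\<lambda>t. vec (d i) (\<lambda>k. x t $ ((\<Sum>j<i. d j) + k)))"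

definition stack :: "real vec list \<Rightarrow> real vec" where
  "stack vs = vec_of_list (concat (map list_of_vec vs))"

definition diag_op :: "nat \<Rightarrow> (nat \<Rightarrow> nat) \<Rightarrow> (nat \<Rightarrow> signal \<Rightarrow> signal) \<Rightarrow> signal \<Rightarrow> signal" where
  "diag_op N d \<Delta> x = (\<lambda>t. stack (map (\<lambda>i. \<Delta> i (part d i x) t) [0..<N]))"

definition diag_mult ::
  "nat \<Rightarrow> (nat \<Rightarrow> nat) \<Rightarrow> (nat \<Rightarrow> real \<Rightarrow> complex mat) \<Rightarrow> real \<Rightarrow> complex mat" where
  "diag_mult N d \<Phi> w = (let B = (\<lambda>a b. bdiag N (\<lambda>i. blk (d i) a b (\<Phi> i w)))
     in four_block_mat (B 0 0) (B 0 1) (B 1 0) (B 1 1))"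

definition admissible ::
  "nat \<Rightarrow> (nat \<Rightarrow> nat) \<Rightarrow> (nat \<Rightarrow> signal \<Rightarrow> signal) \<Rightarrow> (real \<Rightarrow> complex mat) set" where
  "admissible N d \<Delta> = {diag_mult N d \<Phi> | \<Phi>.
     (\<forall>i<N. multiplier (d i) (\<Phi> i) \<and> \<Delta> i \<in> IQC (d i) (\<Phi> i)) \<and>
     (\<forall>\<tau> \<in> {0..1}. scale_op \<tau> (diag_op N d \<Delta>) \<in> IQC (\<Sum>i<N. d i) (diag_mult N d \<Phi>))}"

section \<open>Well-posedness\<close>

text \<open>\<open>y = G u\<close> for an \<open>m \<times> n\<close> stable transfer matrix \<open>G\<close>: multiplication in the frequency
  domain on \<open>L2\<close>, extended causally to \<open>L2e\<close>.\<close>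

definition lti :: "nat \<Rightarrow> nat \<Rightarrow> tfmat \<Rightarrow> signal \<Rightarrow> signal \<Rightarrow> bool" where
  "lti m n G u y \<longleftrightarrow> u \<in> L2e n \<and> y \<in> L2e m \<and>
     (\<forall>T\<ge>0. \<exists>v \<in> L2 m.
        (AE w in lborel. fourier m v w = freq_resp G w *\<^sub>v fourier n (trunc n T u) w) \<and>
        eq_upto T y v)"

text \<open>Network equations with external signals \<open>(r\<^sub>p, r\<^sub>q, r\<^sub>z, r\<^sub>w)\<close> entering at every
  interconnection point; here \<open>q, p\<close> have dimension \<open>d\<close>, \<open>w\<close> dimension \<open>m\<close> and
  \<open>z\<close> dimension \<open>l\<close>.\<close>

definition network_sol ::
  "nat \<Rightarrow> nat \<Rightarrow> nat \<Rightarrow> tfmat \<Rightarrow> tfmat \<Rightarrow> tfmat \<Rightarrow> tfmat \<Rightarrow> real mat \<Rightarrow> (signal \<Rightarrow> signal) \<Rightarrow>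
   signal \<times> signal \<times> signal \<times> signal \<Rightarrow> signal \<times> signal \<times> signal \<times> signal \<Rightarrow> bool" where
  "network_sol d m l Gpq Gpw Gzq Gzw \<Gamma> D = (\<lambda>(rp, rq, rz, rw) (p, q, z, w).
     p \<in> L2e d \<and> q \<in> L2e d \<and> z \<in> L2e l \<and> w \<in> L2e m \<and>
     lti (d + l) (d + m) (four_block_mat Gpq Gpw Gzq Gzw)
       (\<lambda>t. q t @\<^sub>v w t) (\<lambda>t. (p t - rp t) @\<^sub>v (z t - rz t)) \<and>
     eq_sig q (\<lambda>t. D p t + rq t) \<and>
     eq_sig w (\<lambda>t. \<Gamma> *\<^sub>v z t + rw t))"

definition eq_upto4 ::
  "real \<Rightarrow> signal \<times> signal \<times> signal \<times> signal \<Rightarrow> signal \<times> signal \<times> signal \<times> signal \<Rightarrow> bool" where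
  "eq_upto4 T = (\<lambda>(a, b, c, e) (a', b', c', e').
     eq_upto T a a' \<and> eq_upto T b b' \<and> eq_upto T c c' \<and> eq_upto T e e')"

text \<open>The map from external to internal signals exists on \<open>L2e\<close>, is single-valued and is
  causal; single-valuedness is the case \<open>r = r'\<close> of the second conjunct.\<close>

definition well_posed ::
  "nat \<Rightarrow> nat \<Rightarrow> nat \<Rightarrow> tfmat \<Rightarrow> tfmat \<Rightarrow> tfmat \<Rightarrow> tfmat \<Rightarrow> real mat \<Rightarrow> (signal \<Rightarrow> signal) \<Rightarrow> bool"
where
  "well_posed d m l Gpq Gpw Gzq Gzw \<Gamma> D \<longleftrightarrow>
     (let R = L2e d \<times> L2e d \<times> L2e l \<times> L2e m; sol = network_sol d m l Gpq Gpw Gzq Gzw \<Gamma> D in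
      (\<forall>r \<in> R. \<exists>s. sol r s) \<and>
      (\<forall>r \<in> R. \<forall>r' \<in> R. \<forall>s s' T. sol r s \<longrightarrow> sol r' s' \<longrightarrow> eq_upto4 T r r' \<longrightarrow> eq_upto4 T s s'))"

end

theory Submission
  imports Defs
begin

text \<open>
  The equivalence holds for each admissible multiplier separately. Fix one, fix a frequency, and
  write \<open>S = I - \<Gamma> G\<^bsub>zw\<^esub>\<close> and \<open>K = S\<^bsup>-1\<^esup> \<Gamma> G\<^bsub>zq\<^esub>\<close>. A vector \<open>(x, y)\<close> stands for
  \<open>(q, w)\<close>, and the factor multiplying \<open>X\<close> from the right is the interconnection residual
  \<open>R (x, y) = S y - \<Gamma> G\<^bsub>zq\<^esub> x = S (y - K x)\<close>. It vanishes exactly when \<open>y = K x\<close>, and on such vectors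
  \<open>[G\<^bsub>pq\<^esub> G\<^bsub>pw\<^esub>; I 0] (x, K x)\<close> equals \<open>[G\<^bsub>lumped\<^esub>; I] x\<close>. So (b) says that the quadratic form \<open>Q\<close> of
  the first term of (a) is uniformly negative on the kernel of \<open>R\<close>, while (a) says that it becomes
  uniformly negative everywhere once \<open>R\<^sup>* X R\<close> is subtracted. That these agree is Finsler's lemma.

  The direction from (a) to (b) is restriction to the kernel. For the converse a single \<open>X\<close> has to
  serve all frequencies, which is where uniform bounds enter. Put \<open>u = R (x, y)\<close> and split
  \<open>(x, y) = (x, K x) + (0, S\<^bsup>-1\<^esup> u)\<close>. If \<open>Q\<close>, \<open>K\<close> and \<open>S\<^bsup>-1\<^esup>\<close> are bounded over the frequencies, Young's
  inequality absorbs the cross term into half of the strict negativity on the kernel, leaving a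
  term \<open>c |u|\<^sup>2\<close> with \<open>c\<close> independent of the frequency; \<open>X = (c + \<epsilon>/2) I\<close> then suffices. This is
  \<open>uniform_finsler\<close>.

  The boundedness of \<open>S\<^bsup>-1\<^esup>\<close> is assumed, that of the multiplier is part of its definition, and that of
  the transfer matrices follows because a proper rational function without poles on the imaginary
  axis is bounded there (\<open>rational_bounded_imaginary_axis\<close>). The point \<open>\<omega> = \<infinity>\<close> adds one matrix to each
  family and so does not affect boundedness; that the multiplier is still Hermitian there follows by
  passing to the limit (\<open>at_freq_hermitian\<close>).
\<close>

section \<open>Adjoints and congruence\<close>

lemma mat_adjoint_dims [simp]:
  "dim_row (mat_adjoint A) = dim_col A" "dim_col (mat_adjoint A) = dim_row A"
  by (simp_all add: mat_adjoint_def)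

lemma mat_adjoint_carrier: "A \<in> carrier_mat nr nc \<Longrightarrow> mat_adjoint A \<in> carrier_mat nc nr"
  by (intro carrier_matI) auto

lemma index_mat_adjoint [simp]:
  fixes A :: "complex mat"
  shows "i < dim_col A \<Longrightarrow> j < dim_row A \<Longrightarrow> mat_adjoint A $$ (i, j) = cnj (A $$ (j, i))"
  by (simp add: mat_adjoint_def mat_of_rows_index cols_nth)

lemma hermitian_iff:
  "hermitian A \<longleftrightarrow> square_mat A \<and> (\<forall>i<dim_row A. \<forall>j<dim_row A. A $$ (i, j) = cnj (A $$ (j, i)))"
proof (cases "square_mat A")
  case True
  show ?thesis
  proof
    assume "hermitian A"
    then have "mat_adjoint A $$ (i, j) = A $$ (i, j)" for i j by (simp add: hermitian_def)
    then show "square_mat A \<and> (\<forall>i<dim_row A. \<forall>j<dim_row A. A $$ (i, j) = cnj (A $$ (j, i)))"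
      using True index_mat_adjoint[of _ A] by (metis square_mat.simps)
  next
    assume "square_mat A \<and> (\<forall>i<dim_row A. \<forall>j<dim_row A. A $$ (i, j) = cnj (A $$ (j, i)))"
    then have "mat_adjoint A $$ (i, j) = A $$ (i, j)" if "i < dim_row A" "j < dim_col A" for i j
      using that index_mat_adjoint[of i A j] by (metis square_mat.simps)
    then show "hermitian A" unfolding hermitian_def using True by (intro conjI eq_matI) auto
  qed
qed (simp add: hermitian_def)

lemma mat_adjoint_mult:
  fixes A B :: "complex mat"
  assumes "A \<in> carrier_mat nr n" "B \<in> carrier_mat n nc"
  shows "mat_adjoint (A * B) = mat_adjoint B * mat_adjoint A"
  using assms by (intro eq_matI) (auto simp: scalar_prod_def mult.commute intro!: sum.cong)

lemma mat_adjoint_minus: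
  fixes A B :: "complex mat"
  assumes "A \<in> carrier_mat nr nc" "B \<in> carrier_mat nr nc"
  shows "mat_adjoint (A - B) = mat_adjoint A - mat_adjoint B"
  using assms by (intro eq_matI) auto

lemma mat_adjoint_adjoint:
  fixes A :: "complex mat"
  shows "mat_adjoint (mat_adjoint A) = A"
  by (intro eq_matI) auto

lemma hermitian_congruence:
  assumes M: "M \<in> carrier_mat n k" and Q: "Q \<in> carrier_mat n n" "hermitian Q"
  shows "hermitian (mat_adjoint M * Q * M)"
proof -
  note M' = mat_adjoint_carrier[OF M]
  have "mat_adjoint (mat_adjoint M * Q * M) = mat_adjoint M * mat_adjoint (mat_adjoint M * Q)"
    by (rule mat_adjoint_mult[OF mult_carrier_mat[OF M' Q(1)] M])
  also have "\<dots> = mat_adjoint M * (Q * M)"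
    using Q by (simp only: mat_adjoint_mult[OF M' Q(1)] mat_adjoint_adjoint hermitian_def)
  also have "\<dots> = mat_adjoint M * Q * M"
    by (rule assoc_mult_mat[OF M' Q(1) M, symmetric])
  finally show ?thesis using M by (simp add: hermitian_def)
qed

lemma hermitian_minus:
  assumes "A \<in> carrier_mat n n" "B \<in> carrier_mat n n" "hermitian A" "hermitian B"
  shows "hermitian (A - B)"
  using assms by (simp add: hermitian_def mat_adjoint_minus)

lemma adjoint_cscalar_prod:
  fixes A :: "complex mat"
  assumes "A \<in> carrier_mat nr nc" "v \<in> carrier_vec nr" "w \<in> carrier_vec nc"
  shows "(mat_adjoint A *\<^sub>v v) \<bullet>c w = v \<bullet>c (A *\<^sub>v w)"
proof -
  have "(mat_adjoint A *\<^sub>v v) \<bullet>c w = (\<Sum>i<nc. \<Sum>j<nr. cnj (A $$ (j, i)) * v $ j * cnj (w $ i))"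
    using assms by (auto simp: scalar_prod_def sum_distrib_right lessThan_atLeast0 intro!: sum.cong)
  also have "\<dots> = (\<Sum>j<nr. \<Sum>i<nc. cnj (A $$ (j, i)) * v $ j * cnj (w $ i))"
    by (rule sum.swap)
  also have "\<dots> = v \<bullet>c (A *\<^sub>v w)"
    using assms by (auto simp: scalar_prod_def sum_distrib_left lessThan_atLeast0 algebra_simps
        intro!: sum.cong)
  finally show ?thesis .
qed

text \<open>The form of \<open>M\<^sup>* Q M\<close> at \<open>v\<close> is that of \<open>Q\<close> at \<open>M v\<close>; both matrix inequalities are of this shape,
  which lets them be compared on vectors.\<close>

lemma congruence_form:
  fixes M Q :: "complex mat"
  assumes "M \<in> carrier_mat n k" "Q \<in> carrier_mat n n" "v \<in> carrier_vec k"
  shows "((mat_adjoint M * Q * M) *\<^sub>v v) \<bullet>c v = (Q *\<^sub>v (M *\<^sub>v v)) \<bullet>c (M *\<^sub>v v)"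
proof -
  note M' = mat_adjoint_carrier[OF assms(1)]
  have "(mat_adjoint M * Q * M) *\<^sub>v v = mat_adjoint M *\<^sub>v (Q *\<^sub>v (M *\<^sub>v v))"
    using assms M' by (simp add: assoc_mult_mat_vec[of _ k n _ k] assoc_mult_mat_vec[of _ k n _ n])
  then show ?thesis
    using assms by (simp add: adjoint_cscalar_prod)
qed

section \<open>Quadratic forms and norms\<close>

definition sqnorm :: "complex vec \<Rightarrow> real" where
  "sqnorm v = (\<Sum>i<dim_vec v. (cmod (v $ i))\<^sup>2)"

lemma sqnorm_eq: "complex_of_real (sqnorm v) = v \<bullet>c v"
  by (auto simp: sqnorm_def scalar_prod_def lessThan_atLeast0 complex_norm_square simp del: of_real_power
      intro!: sum.cong)

lemma Re_cscalar_self: "Re (v \<bullet>c v) = sqnorm v"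
  by (simp flip: sqnorm_eq)

lemma sqnorm_nonneg [simp]: "0 \<le> sqnorm v"
  by (simp add: sqnorm_def sum_nonneg)

lemma sqnorm_pos: "v \<in> carrier_vec n \<Longrightarrow> v \<noteq> 0\<^sub>v n \<Longrightarrow> 0 < sqnorm v"
  using sqnorm_eq[of v] conjugate_square_eq_0_vec[of v n] sqnorm_nonneg[of v]
  by (cases "sqnorm v = 0") (simp_all add: less_le)

lemma sqnorm_append: "sqnorm (v @\<^sub>v w) = sqnorm v + sqnorm w"
proof -
  have split: "(\<Sum>i<a + b. f i) = (\<Sum>i<a. f i) + (\<Sum>i<b. f (a + i))" for a b and f :: "nat \<Rightarrow> real"
    by (induction b) simp_all
  let ?f = "\<lambda>i. (cmod ((v @\<^sub>v w) $ i))\<^sup>2"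
  have "sqnorm (v @\<^sub>v w) = (\<Sum>i<dim_vec v + dim_vec w. ?f i)"
    by (simp add: sqnorm_def)
  also have "\<dots> = (\<Sum>i<dim_vec v. ?f i) + (\<Sum>i<dim_vec w. ?f (dim_vec v + i))"
    by (rule split)
  finally show ?thesis by (simp add: sqnorm_def)
qed

lemma sqnorm_zero [simp]: "sqnorm (0\<^sub>v n) = 0"
  by (simp add: sqnorm_def)

text \<open>The free weight \<open>t\<close> is what lets a cross term be absorbed into a prescribed fraction of one square
  at the price of a large multiple of the other.\<close>

lemma young_cscalar_prod:
  assumes "v \<in> carrier_vec n" "w \<in> carrier_vec n" "0 < t"
  shows "2 * Re (v \<bullet>c w) \<le> t * sqnorm v + sqnorm w / t"
proof -
  have *: "2 * Re (a * cnj b) \<le> t * (cmod a)\<^sup>2 + (cmod b)\<^sup>2 / t" for a b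
  proof -
    have "0 \<le> (t * cmod a - cmod b)\<^sup>2 / t" using assms by simp
    also have "\<dots> = t * (cmod a)\<^sup>2 + (cmod b)\<^sup>2 / t - 2 * (cmod a * cmod b)"
      using assms(3) by (simp add: power2_diff power_mult_distrib diff_divide_distrib add_divide_distrib)
        (simp add: power2_eq_square)
    finally show ?thesis using complex_Re_le_cmod[of "a * cnj b"] by (simp add: norm_mult)
  qed
  have "2 * Re (v \<bullet>c w) = (\<Sum>i<n. 2 * Re (v $ i * cnj (w $ i)))"
    using assms by (simp add: scalar_prod_def lessThan_atLeast0 sum_distrib_left)
  also have "\<dots> \<le> (\<Sum>i<n. t * (cmod (v $ i))\<^sup>2 + (cmod (w $ i))\<^sup>2 / t)"
    by (intro sum_mono *)
  also have "\<dots> = t * sqnorm v + sqnorm w / t"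
    using assms by (simp add: sqnorm_def sum.distrib sum_distrib_left sum_divide_distrib)
  finally show ?thesis .
qed

lemma sqnorm_add_le:
  assumes "v \<in> carrier_vec n" "w \<in> carrier_vec n"
  shows "sqnorm (v + w) \<le> 2 * sqnorm v + 2 * sqnorm w"
proof -
  have *: "(cmod (a + b))\<^sup>2 \<le> 2 * (cmod a)\<^sup>2 + 2 * (cmod b)\<^sup>2" for a b
  proof -
    have "(cmod (a + b))\<^sup>2 \<le> (cmod a + cmod b)\<^sup>2" by (simp add: norm_triangle_ineq power_mono)
    also have "\<dots> \<le> 2 * (cmod a)\<^sup>2 + 2 * (cmod b)\<^sup>2"
      using zero_le_power2[of "cmod a - cmod b"] by (simp add: power2_eq_square algebra_simps)
    finally show ?thesis .
  qed
  have "sqnorm (v + w) = (\<Sum>i<n. (cmod (v $ i + w $ i))\<^sup>2)"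
    using assms by (auto simp: sqnorm_def intro!: sum.cong)
  also have "\<dots> \<le> (\<Sum>i<n. 2 * (cmod (v $ i))\<^sup>2 + 2 * (cmod (w $ i))\<^sup>2)" by (intro sum_mono *)
  also have "\<dots> = 2 * sqnorm v + 2 * sqnorm w"
    using assms by (simp add: sqnorm_def sum.distrib sum_distrib_left)
  finally show ?thesis .
qed

text \<open>The spectral norm is at most the Frobenius norm, and that is bounded through the entries.\<close>

lemma sqnorm_mult_mat_vec_le:
  assumes A: "A \<in> carrier_mat nr nc" and c: "norm_bound A c" and v: "v \<in> carrier_vec nc"
  shows "sqnorm (A *\<^sub>v v) \<le> real nr * real nc * c\<^sup>2 * sqnorm v"
proof -
  have row: "(cmod ((A *\<^sub>v v) $ i))\<^sup>2 \<le> real nc * c\<^sup>2 * sqnorm v" if i: "i < nr" for i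
  proof -
    have "cmod ((A *\<^sub>v v) $ i) = cmod (\<Sum>j<nc. A $$ (i, j) * v $ j)"
      using A v i by (simp add: scalar_prod_def lessThan_atLeast0)
    also have "\<dots> \<le> (\<Sum>j<nc. cmod (A $$ (i, j)) * cmod (v $ j))"
      by (rule order_trans[OF norm_sum]) (simp add: norm_mult)
    finally have "(cmod ((A *\<^sub>v v) $ i))\<^sup>2 \<le> (\<Sum>j<nc. cmod (A $$ (i, j)) * cmod (v $ j))\<^sup>2"
      by (intro power_mono) auto
    also have "\<dots> \<le> (\<Sum>j<nc. (cmod (A $$ (i, j)))\<^sup>2) * (\<Sum>j<nc. (cmod (v $ j))\<^sup>2)"
      by (rule Cauchy_Schwarz_ineq_sum)
    also have "\<dots> \<le> (\<Sum>j<nc. c\<^sup>2) * (\<Sum>j<nc. (cmod (v $ j))\<^sup>2)"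
      using A c i by (intro mult_right_mono sum_mono power_mono sum_nonneg) (auto simp: norm_bound_def)
    finally show ?thesis using v by (simp add: sqnorm_def)
  qed
  have "sqnorm (A *\<^sub>v v) = (\<Sum>i<nr. (cmod ((A *\<^sub>v v) $ i))\<^sup>2)" using A by (simp add: sqnorm_def)
  also have "\<dots> \<le> (\<Sum>i<nr. real nc * c\<^sup>2 * sqnorm v)" by (intro sum_mono row) auto
  finally show ?thesis by simp
qed

lemma cscalar_prod_swap:
  fixes v w :: "complex vec"
  assumes "v \<in> carrier_vec n" "w \<in> carrier_vec n"
  shows "w \<bullet>c v = cnj (v \<bullet>c w)"
  using assms by (simp add: scalar_prod_def mult.commute)

text \<open>For Hermitian \<open>Q\<close> the two cross terms of the form are complex conjugates of each other, so they
  contribute twice the real part of one of them.\<close>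

lemma hermitian_form_add:
  assumes Q: "Q \<in> carrier_mat n n" "hermitian Q" and v: "v \<in> carrier_vec n" "w \<in> carrier_vec n"
  shows "Re ((Q *\<^sub>v (v + w)) \<bullet>c (v + w)) =
    Re ((Q *\<^sub>v v) \<bullet>c v) + 2 * Re ((Q *\<^sub>v v) \<bullet>c w) + Re ((Q *\<^sub>v w) \<bullet>c w)"
proof -
  have car: "Q *\<^sub>v v \<in> carrier_vec n" "Q *\<^sub>v w \<in> carrier_vec n" using Q v by auto
  have "(Q *\<^sub>v w) \<bullet>c v = w \<bullet>c (Q *\<^sub>v v)"
    using adjoint_cscalar_prod[OF Q(1) v(2,1)] Q(2) by (simp add: hermitian_def)
  also have "\<dots> = cnj ((Q *\<^sub>v v) \<bullet>c w)"
    by (rule cscalar_prod_swap[OF car(1) v(2)])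
  finally have sym: "Re ((Q *\<^sub>v w) \<bullet>c v) = Re ((Q *\<^sub>v v) \<bullet>c w)" by simp
  have "(Q *\<^sub>v (v + w)) \<bullet>c (v + w) = (Q *\<^sub>v v) \<bullet>c v + (Q *\<^sub>v v) \<bullet>c w + ((Q *\<^sub>v w) \<bullet>c v + (Q *\<^sub>v w) \<bullet>c w)"
    using Q v car by (simp add: mult_add_distrib_mat_vec[of _ n n] conjugate_add_vec[of _ n]
       add_scalar_prod_distrib[of _ n] scalar_prod_add_distrib[of _ n])
  then show ?thesis using sym by simp
qed

text \<open>The passage from matrix inequalities to bounds on quadratic forms. Hermitian symmetry is a premise
  since \<^const>\<open>loewner_le\<close> demands it and a bound on real parts does not imply it.\<close>

lemma loewner_le_neg_iff:
  assumes A: "A \<in> carrier_mat n n" "hermitian A"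
  shows "loewner_le n A (- complex_of_real \<epsilon> \<cdot>\<^sub>m 1\<^sub>m n) \<longleftrightarrow>
    (\<forall>v \<in> carrier_vec n. Re ((A *\<^sub>v v) \<bullet>c v) \<le> - \<epsilon> * sqnorm v)"
proof -
  let ?E = "- complex_of_real \<epsilon> \<cdot>\<^sub>m 1\<^sub>m n :: complex mat"
  have E: "?E \<in> carrier_mat n n" "hermitian ?E" by (auto simp: hermitian_iff)
  have "Re (((?E - A) *\<^sub>v v) \<bullet>c v) = - \<epsilon> * sqnorm v - Re ((A *\<^sub>v v) \<bullet>c v)"
    if v: "v \<in> carrier_vec n" for v
  proof -
    have Av: "A *\<^sub>v v \<in> carrier_vec n" using A v by auto
    have "?E *\<^sub>v v = - complex_of_real \<epsilon> \<cdot>\<^sub>v v"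
      using v by (intro eq_vecI) (auto simp: row_smult)
    then have "(?E - A) *\<^sub>v v = - complex_of_real \<epsilon> \<cdot>\<^sub>v v - A *\<^sub>v v"
      using A E v by (simp add: minus_mult_distrib_mat_vec[of _ n n])
    then show ?thesis
      using v Av by (simp add: minus_scalar_prod_distrib[of _ n] Re_cscalar_self)
  qed
  then show ?thesis
    using A E hermitian_minus[OF E(1) A(1) E(2) A(2)]
    by (auto simp: loewner_le_def pos_semidef_def)
qed

section \<open>Uniformly bounded families of matrices\<close>

text \<open>The bound is entrywise. For matrices of fixed size this is equivalent to a bound in any matrix
  norm, and it is the form in which the bounds on multipliers and inverses are given.\<close>

definition uniformly_bounded :: "'a set \<Rightarrow> ('a \<Rightarrow> complex mat) \<Rightarrow> bool" where
  "uniformly_bounded I F \<longleftrightarrow> (\<exists>c. \<forall>\<omega>\<in>I. norm_bound (F \<omega>) c)"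

lemma uniformly_bounded_entrywise:
  assumes "\<And>\<omega>. \<omega> \<in> I \<Longrightarrow> F \<omega> \<in> carrier_mat nr nc"
    and "\<And>i j. i < nr \<Longrightarrow> j < nc \<Longrightarrow> \<exists>c. \<forall>\<omega>\<in>I. cmod (F \<omega> $$ (i, j)) \<le> c"
  shows "uniformly_bounded I F"
proof -
  from assms(2) obtain c where
    c: "\<And>i j \<omega>. i < nr \<Longrightarrow> j < nc \<Longrightarrow> \<omega> \<in> I \<Longrightarrow> cmod (F \<omega> $$ (i, j)) \<le> c i j"
    by metis
  let ?C = "\<Sum>i<nr. \<Sum>j<nc. \<bar>c i j\<bar>"
  have "cmod (F \<omega> $$ (i, j)) \<le> ?C" if "\<omega> \<in> I" "i < nr" "j < nc" for \<omega> i j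
  proof -
    have "cmod (F \<omega> $$ (i, j)) \<le> \<bar>c i j\<bar>" using c[OF that(2,3,1)] by linarith
    also have "\<dots> \<le> (\<Sum>j<nc. \<bar>c i j\<bar>)"
      using that by (intro member_le_sum) auto
    also have "\<dots> \<le> ?C"
      using that by (intro member_le_sum[where f = "\<lambda>i. \<Sum>j<nc. \<bar>c i j\<bar>"]) (auto intro!: sum_nonneg)
    finally show ?thesis .
  qed
  then have "\<forall>\<omega>\<in>I. norm_bound (F \<omega>) ?C"
    using assms(1) by (fastforce simp: norm_bound_def)
  then show ?thesis unfolding uniformly_bounded_def by blast
qed

lemma uniformly_bounded_mult:
  assumes F: "\<And>\<omega>. \<omega> \<in> I \<Longrightarrow> F \<omega> \<in> carrier_mat nr n" "uniformly_bounded I F"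
    and G: "\<And>\<omega>. \<omega> \<in> I \<Longrightarrow> G \<omega> \<in> carrier_mat n nc" "uniformly_bounded I G"
  shows "uniformly_bounded I (\<lambda>\<omega>. F \<omega> * G \<omega>)"
  using assms norm_bound_mult unfolding uniformly_bounded_def by blast

lemma uniformly_bounded_adjoint:
  assumes "uniformly_bounded I F"
  shows "uniformly_bounded I (\<lambda>\<omega>. mat_adjoint (F \<omega>))"
proof -
  have "norm_bound (mat_adjoint A) c" if "norm_bound A c" for A :: "complex mat" and c
    using that by (simp add: norm_bound_def)
  then show ?thesis using assms unfolding uniformly_bounded_def by blast
qed

lemma uniformly_bounded_four_block:
  assumes "\<And>\<omega>. \<omega> \<in> I \<Longrightarrow> A \<omega> \<in> carrier_mat nr1 nc1" "\<And>\<omega>. \<omega> \<in> I \<Longrightarrow> B \<omega> \<in> carrier_mat nr1 nc2"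
    "\<And>\<omega>. \<omega> \<in> I \<Longrightarrow> C \<omega> \<in> carrier_mat nr2 nc1" "\<And>\<omega>. \<omega> \<in> I \<Longrightarrow> D \<omega> \<in> carrier_mat nr2 nc2"
    and "uniformly_bounded I A" "uniformly_bounded I B" "uniformly_bounded I C" "uniformly_bounded I D"
  shows "uniformly_bounded I (\<lambda>\<omega>. four_block_mat (A \<omega>) (B \<omega>) (C \<omega>) (D \<omega>))"
proof -
  from assms(5-8) obtain a b c d where
    bd: "\<And>\<omega>. \<omega> \<in> I \<Longrightarrow> norm_bound (A \<omega>) a" "\<And>\<omega>. \<omega> \<in> I \<Longrightarrow> norm_bound (B \<omega>) b"
      "\<And>\<omega>. \<omega> \<in> I \<Longrightarrow> norm_bound (C \<omega>) c" "\<And>\<omega>. \<omega> \<in> I \<Longrightarrow> norm_bound (D \<omega>) d"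
    unfolding uniformly_bounded_def by blast
  show ?thesis
  proof (rule uniformly_bounded_entrywise)
    show "four_block_mat (A \<omega>) (B \<omega>) (C \<omega>) (D \<omega>) \<in> carrier_mat (nr1 + nr2) (nc1 + nc2)" if "\<omega> \<in> I" for \<omega>
      by (rule four_block_carrier_mat[OF assms(1,4)[OF that]])
    have "cmod (four_block_mat (A \<omega>) (B \<omega>) (C \<omega>) (D \<omega>) $$ (i, j)) \<le> \<bar>a\<bar> + \<bar>b\<bar> + \<bar>c\<bar> + \<bar>d\<bar>"
      if I: "\<omega> \<in> I" and ij: "i < nr1 + nr2" "j < nc1 + nc2" for \<omega> i j
    proof -
      note car = assms(1-4)[OF I]
      have 1: "cmod (A \<omega> $$ (i, j)) \<le> a" if "i < nr1" "j < nc1"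
        using that bd(1)[OF I] car(1) by (simp add: norm_bound_def)
      have 2: "cmod (B \<omega> $$ (i, j - nc1)) \<le> b" if "i < nr1" "\<not> j < nc1"
        using that ij bd(2)[OF I] car(2) by (simp add: norm_bound_def)
      have 3: "cmod (C \<omega> $$ (i - nr1, j)) \<le> c" if "\<not> i < nr1" "j < nc1"
        using that ij bd(3)[OF I] car(3) by (simp add: norm_bound_def)
      have 4: "cmod (D \<omega> $$ (i - nr1, j - nc1)) \<le> d" if "\<not> i < nr1" "\<not> j < nc1"
        using that ij bd(4)[OF I] car(4) by (simp add: norm_bound_def)
      have "four_block_mat (A \<omega>) (B \<omega>) (C \<omega>) (D \<omega>) $$ (i, j) =
          (if i < nr1 then if j < nc1 then A \<omega> $$ (i, j) else B \<omega> $$ (i, j - nc1)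
           else if j < nc1 then C \<omega> $$ (i - nr1, j) else D \<omega> $$ (i - nr1, j - nc1))"
        using ij car by simp
      then show ?thesis using 1 2 3 4 by (smt (verit))
    qed
    then show "\<exists>k. \<forall>\<omega>\<in>I. cmod (four_block_mat (A \<omega>) (B \<omega>) (C \<omega>) (D \<omega>) $$ (i, j)) \<le> k"
      if "i < nr1 + nr2" "j < nc1 + nc2" for i j using that by blast
  qed
qed

lemma uniformly_bounded_const: "uniformly_bounded I (\<lambda>_. A)"
  using norm_bound_max unfolding uniformly_bounded_def by blast

lemma uniformly_bounded_sqnorm:
  assumes "\<And>\<omega>. \<omega> \<in> I \<Longrightarrow> F \<omega> \<in> carrier_mat nr nc" "uniformly_bounded I F"
  shows "\<exists>k\<ge>0. \<forall>\<omega>\<in>I. \<forall>v\<in>carrier_vec nc. sqnorm (F \<omega> *\<^sub>v v) \<le> k * sqnorm v"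
proof -
  from assms(2) obtain c where c: "\<And>\<omega>. \<omega> \<in> I \<Longrightarrow> norm_bound (F \<omega>) c"
    unfolding uniformly_bounded_def by blast
  show ?thesis
    using sqnorm_mult_mat_vec_le[OF assms(1) c] by (intro exI[of _ "real nr * real nc * c\<^sup>2"]) auto
qed

section \<open>Finsler's lemma with a uniform multiplier\<close>

text \<open>A version of Finsler's lemma for families. The last premise brings \<open>R\<close> into the form whose kernel
  is the graph of \<open>K\<close>, and \<open>T\<close> is the inverse of \<open>S\<close>. With \<open>u = R (x, y)\<close> one has
  \<open>(x, y) = (x, K x) + (0, T u)\<close>, so \<open>|x|\<^sup>2 + |u|\<^sup>2\<close> is uniformly equivalent to \<open>|(x, y)|\<^sup>2\<close>, and in these
  coordinates a large multiple of \<open>|u|\<^sup>2\<close> dominates everything except the form on the kernel.\<close>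

lemma uniform_finsler:
  fixes Q K R S T :: "'a \<Rightarrow> complex mat"
  assumes Q: "\<And>\<omega>. \<omega> \<in> I \<Longrightarrow> Q \<omega> \<in> carrier_mat (d + m) (d + m)" "\<And>\<omega>. \<omega> \<in> I \<Longrightarrow> hermitian (Q \<omega>)"
      "uniformly_bounded I Q"
    and K: "\<And>\<omega>. \<omega> \<in> I \<Longrightarrow> K \<omega> \<in> carrier_mat m d" "uniformly_bounded I K"
    and T: "\<And>\<omega>. \<omega> \<in> I \<Longrightarrow> T \<omega> \<in> carrier_mat m m" "uniformly_bounded I T"
    and S: "\<And>\<omega>. \<omega> \<in> I \<Longrightarrow> S \<omega> \<in> carrier_mat m m" "\<And>\<omega>. \<omega> \<in> I \<Longrightarrow> T \<omega> * S \<omega> = 1\<^sub>m m"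
    and R: "\<And>\<omega> x y. \<omega> \<in> I \<Longrightarrow> x \<in> carrier_vec d \<Longrightarrow> y \<in> carrier_vec m \<Longrightarrow>
      R \<omega> *\<^sub>v (x @\<^sub>v y) = S \<omega> *\<^sub>v (y - K \<omega> *\<^sub>v x)"
  shows "(\<exists>X\<in>carrier_mat m m. \<exists>\<epsilon>>0. pos_def X \<and> (\<forall>\<omega>\<in>I. \<forall>v\<in>carrier_vec (d + m).
        Re ((Q \<omega> *\<^sub>v v) \<bullet>c v) - Re ((X *\<^sub>v (R \<omega> *\<^sub>v v)) \<bullet>c (R \<omega> *\<^sub>v v)) \<le> - \<epsilon> * sqnorm v))
    \<longleftrightarrow> (\<exists>\<epsilon>>0. \<forall>\<omega>\<in>I. \<forall>x\<in>carrier_vec d.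
        Re ((Q \<omega> *\<^sub>v (x @\<^sub>v K \<omega> *\<^sub>v x)) \<bullet>c (x @\<^sub>v K \<omega> *\<^sub>v x)) \<le> - \<epsilon> * sqnorm x)"
    (is "?relaxed \<longleftrightarrow> ?restricted")
proof
  assume ?relaxed
  then obtain X \<epsilon> where X: "X \<in> carrier_mat m m" and \<epsilon>: "0 < \<epsilon>"
    and le: "\<And>\<omega> v. \<omega> \<in> I \<Longrightarrow> v \<in> carrier_vec (d + m) \<Longrightarrow>
        Re ((Q \<omega> *\<^sub>v v) \<bullet>c v) - Re ((X *\<^sub>v (R \<omega> *\<^sub>v v)) \<bullet>c (R \<omega> *\<^sub>v v)) \<le> - \<epsilon> * sqnorm v"
    by blast
  have "Re ((Q \<omega> *\<^sub>v (x @\<^sub>v K \<omega> *\<^sub>v x)) \<bullet>c (x @\<^sub>v K \<omega> *\<^sub>v x)) \<le> - \<epsilon> * sqnorm x"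
    if \<omega>: "\<omega> \<in> I" and x: "x \<in> carrier_vec d" for \<omega> x
  proof -
    let ?v = "x @\<^sub>v K \<omega> *\<^sub>v x"
    have Kx: "K \<omega> *\<^sub>v x \<in> carrier_vec m" using K(1)[OF \<omega>] x by (rule mult_mat_vec_carrier)
    have "R \<omega> *\<^sub>v ?v = S \<omega> *\<^sub>v 0\<^sub>v m" using R[OF \<omega> x Kx] Kx by simp
    also have "\<dots> = 0\<^sub>v m" using S(1)[OF \<omega>] by (intro eq_vecI) auto
    finally have "Re ((Q \<omega> *\<^sub>v ?v) \<bullet>c ?v) \<le> - \<epsilon> * sqnorm ?v"
      using le[OF \<omega> append_carrier_vec[OF x Kx]] X by simp
    also have "\<dots> \<le> - \<epsilon> * sqnorm x"
      using \<epsilon> by (simp add: sqnorm_append)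
    finally show ?thesis .
  qed
  then show ?restricted using \<epsilon> by blast
next
  assume ?restricted
  then obtain \<epsilon> where \<epsilon>: "0 < \<epsilon>"
    and le: "\<And>\<omega> x. \<omega> \<in> I \<Longrightarrow> x \<in> carrier_vec d \<Longrightarrow>
        Re ((Q \<omega> *\<^sub>v (x @\<^sub>v K \<omega> *\<^sub>v x)) \<bullet>c (x @\<^sub>v K \<omega> *\<^sub>v x)) \<le> - \<epsilon> * sqnorm x"
    by blast
  obtain q where q: "0 \<le> q"
    "\<And>\<omega> v. \<omega> \<in> I \<Longrightarrow> v \<in> carrier_vec (d + m) \<Longrightarrow> sqnorm (Q \<omega> *\<^sub>v v) \<le> q * sqnorm v"
    using uniformly_bounded_sqnorm[OF Q(1,3)] by blast
  obtain k where k: "0 \<le> k"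
    "\<And>\<omega> v. \<omega> \<in> I \<Longrightarrow> v \<in> carrier_vec d \<Longrightarrow> sqnorm (K \<omega> *\<^sub>v v) \<le> k * sqnorm v"
    using uniformly_bounded_sqnorm[OF K] by blast
  obtain t where t: "0 \<le> t"
    "\<And>\<omega> v. \<omega> \<in> I \<Longrightarrow> v \<in> carrier_vec m \<Longrightarrow> sqnorm (T \<omega> *\<^sub>v v) \<le> t * sqnorm v"
    using uniformly_bounded_sqnorm[OF T] by blast
  \<comment> \<open>The kernel vector \<open>(x, K x)\<close> has squared norm at most \<open>(1 + k) |x|\<^sup>2\<close>, so \<open>g |x|\<^sup>2\<close> dominates its image
    under \<open>Q\<close>; the extra 1 keeps \<open>g\<close> positive.\<close>
  define g where "g = q * (1 + k) + 1"
  have g: "0 < g" "q * (1 + k) \<le> g" using q(1) k(1) by (simp_all add: g_def add_nonneg_pos)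
  \<comment> \<open>This weight lets the cross term cost at most half of the available margin on the kernel.\<close>
  define \<delta> where "\<delta> = \<epsilon> / (2 * g)"
  have \<delta>: "0 < \<delta>" "\<delta> * g = \<epsilon> / 2" using \<epsilon> g by (simp_all add: \<delta>_def)
  \<comment> \<open>With these, \<open>c |u|\<^sup>2\<close> bounds the form at \<open>(0, T u)\<close> plus what Young leaves of the cross term, and
    \<open>h\<close> compares \<open>|(x, y)|\<^sup>2\<close> with \<open>|x|\<^sup>2 + |u|\<^sup>2\<close>.\<close>
  define c where "c = (q + 1 + 1 / \<delta>) * t"
  have c: "0 \<le> c" using q(1) t(1) \<delta>(1) by (simp add: c_def)
  define h where "h = 1 + 2 * k + 2 * t"
  have h: "0 < h" using k(1) t(1) by (simp add: h_def)
  \<comment> \<open>Beyond cancelling \<open>c\<close>, the multiple must produce a margin in \<open>u\<close> equal to the one left in \<open>x\<close>.\<close>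
  define \<alpha> where "\<alpha> = c + \<epsilon> / 2"
  have \<alpha>: "0 < \<alpha>" using c \<epsilon> by (simp add: \<alpha>_def)
  define X where "X = complex_of_real \<alpha> \<cdot>\<^sub>m 1\<^sub>m m"
  have X: "X \<in> carrier_mat m m" by (simp add: X_def)
  have formX: "Re ((X *\<^sub>v u) \<bullet>c u) = \<alpha> * sqnorm u" if u: "u \<in> carrier_vec m" for u
  proof -
    have "X *\<^sub>v u = complex_of_real \<alpha> \<cdot>\<^sub>v u"
      unfolding X_def using u by (intro eq_vecI) (auto simp: row_smult)
    then show ?thesis using u by (simp add: Re_cscalar_self)
  qed
  have "hermitian X" by (auto simp: X_def hermitian_iff)
  then have X_pos: "pos_def X"
    unfolding pos_def_def using X formX \<alpha> sqnorm_pos by auto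
  have "Re ((Q \<omega> *\<^sub>v v) \<bullet>c v) - Re ((X *\<^sub>v (R \<omega> *\<^sub>v v)) \<bullet>c (R \<omega> *\<^sub>v v)) \<le> - (\<epsilon> / 2 / h) * sqnorm v"
    if \<omega>: "\<omega> \<in> I" and v: "v \<in> carrier_vec (d + m)" for \<omega> v
  proof -
    \<comment> \<open>The coordinates \<open>(x, u)\<close>: the kernel component is \<open>a\<close>, the transversal one is \<open>b\<close>.\<close>
    define x y where "x = vec_first v d" and "y = vec_last v m"
    have x: "x \<in> carrier_vec d" and y: "y \<in> carrier_vec m" and v_eq: "v = x @\<^sub>v y"
      using v by (simp_all add: x_def y_def)
    have Kx: "K \<omega> *\<^sub>v x \<in> carrier_vec m" using K(1)[OF \<omega>] x by (rule mult_mat_vec_carrier)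
    define u where "u = R \<omega> *\<^sub>v v"
    have u_eq: "u = S \<omega> *\<^sub>v (y - K \<omega> *\<^sub>v x)" unfolding u_def v_eq by (rule R[OF \<omega> x y])
    have yKx: "y - K \<omega> *\<^sub>v x \<in> carrier_vec m" using y Kx by simp
    have u: "u \<in> carrier_vec m" unfolding u_eq using S(1)[OF \<omega>] yKx by (rule mult_mat_vec_carrier)
    have Tu_eq: "T \<omega> *\<^sub>v u = y - K \<omega> *\<^sub>v x"
      unfolding u_eq using assoc_mult_mat_vec[OF T(1)[OF \<omega>] S(1)[OF \<omega>] yKx] S(2)[OF \<omega>] yKx by simp
    have y_eq: "y = K \<omega> *\<^sub>v x + T \<omega> *\<^sub>v u"
      unfolding Tu_eq using y K(1)[OF \<omega>] by (intro eq_vecI) auto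
    have Tu: "T \<omega> *\<^sub>v u \<in> carrier_vec m" using Tu_eq yKx by simp
    define a b where "a = x @\<^sub>v K \<omega> *\<^sub>v x" and "b = 0\<^sub>v d @\<^sub>v T \<omega> *\<^sub>v u"
    have a: "a \<in> carrier_vec (d + m)" and b: "b \<in> carrier_vec (d + m)"
      unfolding a_def b_def using x Kx Tu by auto
    have ab: "v = a + b"
      unfolding v_eq a_def b_def append_vec_add[OF x zero_carrier_vec Kx Tu] y_eq[symmetric]
      using x by simp
    have Qa: "Q \<omega> *\<^sub>v a \<in> carrier_vec (d + m)" and Qb: "Q \<omega> *\<^sub>v b \<in> carrier_vec (d + m)"
      using mult_mat_vec_carrier[OF Q(1)[OF \<omega>]] a b by auto
    have na: "sqnorm a \<le> (1 + k) * sqnorm x"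
      using k(2)[OF \<omega> x] by (simp add: a_def sqnorm_append algebra_simps)
    have nb: "sqnorm b \<le> t * sqnorm u"
      using t(2)[OF \<omega> u] by (simp add: b_def sqnorm_append)
    have "sqnorm (Q \<omega> *\<^sub>v a) \<le> q * ((1 + k) * sqnorm x)"
      by (rule order_trans[OF q(2)[OF \<omega> a] mult_left_mono[OF na q(1)]])
    also have "\<dots> \<le> g * sqnorm x"
      using mult_right_mono[OF g(2) sqnorm_nonneg[of x]] by (simp add: mult.assoc)
    finally have nQa: "\<delta> * sqnorm (Q \<omega> *\<^sub>v a) \<le> \<epsilon> / 2 * sqnorm x"
      using mult_left_mono[of "sqnorm (Q \<omega> *\<^sub>v a)" "g * sqnorm x" \<delta>] \<delta> by (simp flip: mult.assoc)
    have aa: "Re ((Q \<omega> *\<^sub>v a) \<bullet>c a) \<le> - \<epsilon> * sqnorm x"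
      unfolding a_def by (rule le[OF \<omega> x])
    have ab_le: "2 * Re ((Q \<omega> *\<^sub>v a) \<bullet>c b) \<le> \<epsilon> / 2 * sqnorm x + sqnorm b / \<delta>"
      using young_cscalar_prod[OF Qa b \<delta>(1)] nQa by linarith
    have "2 * Re ((Q \<omega> *\<^sub>v b) \<bullet>c b) \<le> sqnorm (Q \<omega> *\<^sub>v b) + sqnorm b"
      using young_cscalar_prod[OF Qb b, of 1] by simp
    then have bb: "Re ((Q \<omega> *\<^sub>v b) \<bullet>c b) \<le> (q + 1) * sqnorm b"
      using q(2)[OF \<omega> b] mult_nonneg_nonneg[OF q(1) sqnorm_nonneg[of b]] sqnorm_nonneg[of b]
      unfolding distrib_right mult_1 by linarith
    have "(q + 1 + 1 / \<delta>) * sqnorm b \<le> c * sqnorm u"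
      unfolding c_def using q(1) \<delta>(1) by (subst mult.assoc) (intro mult_left_mono nb, simp)
    moreover have "(q + 1 + 1 / \<delta>) * sqnorm b = (q + 1) * sqnorm b + sqnorm b / \<delta>"
      by (simp add: distrib_right)
    ultimately have form: "Re ((Q \<omega> *\<^sub>v v) \<bullet>c v) \<le> - (\<epsilon> / 2) * sqnorm x + c * sqnorm u"
      unfolding ab hermitian_form_add[OF Q(1,2)[OF \<omega>] a b] using aa ab_le bb by linarith
    have "sqnorm y \<le> 2 * (k * sqnorm x) + 2 * (t * sqnorm u)"
      using sqnorm_add_le[OF Kx Tu] k(2)[OF \<omega> x] t(2)[OF \<omega> u] unfolding y_eq[symmetric] by linarith
    moreover have "h * (sqnorm x + sqnorm u) = sqnorm x + sqnorm u +
        2 * (k * sqnorm x) + 2 * (k * sqnorm u) + 2 * (t * sqnorm x) + 2 * (t * sqnorm u)"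
      by (simp add: h_def algebra_simps)
    moreover have "0 \<le> k * sqnorm u" "0 \<le> t * sqnorm x" using k(1) t(1) by simp_all
    ultimately have "sqnorm v \<le> h * (sqnorm x + sqnorm u)"
      unfolding v_eq sqnorm_append using sqnorm_nonneg[of u] by linarith
    then have "(\<epsilon> / 2 / h) * sqnorm v \<le> (\<epsilon> / 2 / h) * (h * (sqnorm x + sqnorm u))"
      using \<epsilon> h by (intro mult_left_mono) auto
    also have "\<dots> = \<epsilon> / 2 * sqnorm x + \<epsilon> / 2 * sqnorm u"
      using h by (simp add: distrib_left)
    finally show ?thesis
      using form formX[OF u] unfolding u_def[symmetric] \<alpha>_def by (simp add: distrib_right)
  qed
  moreover have "0 < \<epsilon> / 2 / h" using \<epsilon> h by simp
  ultimately show ?relaxed using X X_pos by blast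
qed

section \<open>Block diagonal matrices\<close>

lemma bdiag_Suc:
  "bdiag (Suc N) A = four_block_mat (bdiag N A) (0\<^sub>m (dim_row (bdiag N A)) (dim_col (A N)))
     (0\<^sub>m (dim_row (A N)) (dim_col (bdiag N A))) (A N)"
  by (simp add: bdiag_def diag_block_mat_last Let_def)

lemma bdiag_carrier:
  assumes "\<And>k. k < N \<Longrightarrow> A k \<in> carrier_mat (r k) (c k)"
  shows "bdiag N A \<in> carrier_mat (\<Sum>k<N. r k) (\<Sum>k<N. c k)"
  using assms
proof (induction N)
  case 0
  show ?case by (simp add: bdiag_def)
next
  case (Suc N)
  have "bdiag N A \<in> carrier_mat (\<Sum>k<N. r k) (\<Sum>k<N. c k)" using Suc by simp
  moreover have "A N \<in> carrier_mat (r N) (c N)" using Suc.prems by simp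
  ultimately show ?case by (simp add: bdiag_Suc)
qed

text \<open>Which block an entry comes from depends only on its position. So a property of functions of \<open>s\<close>, such
  as having a limit, passes to the entries of a parametrised block diagonal matrix as soon as the zero
  function and the entries of the blocks have it.\<close>

lemma bdiag_entries:
  assumes "\<And>s k. k < N \<Longrightarrow> A s k \<in> carrier_mat (r k) (c k)"
    and "P (\<lambda>_. 0)"
    and "\<And>k i j. k < N \<Longrightarrow> i < r k \<Longrightarrow> j < c k \<Longrightarrow> P (\<lambda>s. A s k $$ (i, j))"
    and "i < (\<Sum>k<N. r k)" "j < (\<Sum>k<N. c k)"
  shows "P (\<lambda>s. bdiag N (A s) $$ (i, j))"
  using assms
proof (induction N arbitrary: i j)
  case 0
  then show ?case by simp
next
  case (Suc N)
  let ?R = "\<Sum>k<N. r k" and ?C = "\<Sum>k<N. c k"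
  have B: "bdiag N (A s) \<in> carrier_mat ?R ?C" for s
    using Suc.prems(1) by (intro bdiag_carrier) simp
  have AN: "A s N \<in> carrier_mat (r N) (c N)" for s using Suc.prems(1) by simp
  have idx: "bdiag (Suc N) (A s) $$ (i, j) =
      (if i < ?R then if j < ?C then bdiag N (A s) $$ (i, j) else 0
       else if j < ?C then 0 else A s N $$ (i - ?R, j - ?C))" for s
    using B[of s] AN[of s] Suc.prems(4,5) by (simp add: bdiag_Suc)
  have IH: "P (\<lambda>s. bdiag N (A s) $$ (i, j))" if "i < ?R" "j < ?C"
    using Suc.prems(1-3) that by (intro Suc.IH) auto
  have last: "P (\<lambda>s. A s N $$ (i - ?R, j - ?C))" if "\<not> i < ?R" "\<not> j < ?C"
    using Suc.prems(4,5) that by (intro Suc.prems(3)) auto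
  show ?case
    unfolding idx by (cases "i < ?R"; cases "j < ?C") (simp_all add: IH last Suc.prems(2))
qed

lemma mat_adjoint_four_block:
  fixes A B C D :: "complex mat"
  assumes "A \<in> carrier_mat nr1 nc1" "B \<in> carrier_mat nr1 nc2"
    "C \<in> carrier_mat nr2 nc1" "D \<in> carrier_mat nr2 nc2"
  shows "mat_adjoint (four_block_mat A B C D) =
    four_block_mat (mat_adjoint A) (mat_adjoint C) (mat_adjoint B) (mat_adjoint D)"
  using assms by (intro eq_matI) auto

lemma mat_adjoint_zero: "mat_adjoint (0\<^sub>m nr nc :: complex mat) = 0\<^sub>m nc nr"
  by (intro eq_matI) auto

lemma mat_adjoint_bdiag:
  fixes A :: "nat \<Rightarrow> complex mat"
  assumes "\<And>k. k < N \<Longrightarrow> A k \<in> carrier_mat (r k) (c k)"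
  shows "mat_adjoint (bdiag N A) = bdiag N (\<lambda>k. mat_adjoint (A k))"
  using assms
proof (induction N)
  case 0
  show ?case by (simp add: bdiag_def mat_adjoint_zero)
next
  case (Suc N)
  let ?B = "bdiag N A"
  have IH: "mat_adjoint ?B = bdiag N (\<lambda>k. mat_adjoint (A k))" using Suc by simp
  have "mat_adjoint (bdiag (Suc N) A) = four_block_mat (mat_adjoint ?B)
      (0\<^sub>m (dim_col ?B) (dim_row (A N))) (0\<^sub>m (dim_col (A N)) (dim_row ?B)) (mat_adjoint (A N))"
    unfolding bdiag_Suc by (subst mat_adjoint_four_block[OF carrier_mat_triv _ _ carrier_mat_triv])
      (auto simp: mat_adjoint_zero)
  also have "\<dots> = bdiag (Suc N) (\<lambda>k. mat_adjoint (A k))"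
    unfolding bdiag_Suc by (simp flip: IH)
  finally show ?case .
qed

section \<open>Frequency responses on the extended half axis\<close>

text \<open>Substituting \<open>u = 1/z\<close> turns \<open>p/q\<close> into
  \<open>u\<^bsup>deg q - deg p\<^esup> p\<^sup>r(u) / q\<^sup>r(u)\<close> with the reversed polynomials; as \<open>q\<^sup>r(0)\<close> is the leading coefficient
  of \<open>q\<close>, this is continuous at \<open>u = 0\<close>. Hence \<open>p/q\<close> has a limit at infinity, and on the remaining
  compact part of the half axis it is bounded by continuity.\<close>

lemma rational_bounded_imaginary_axis:
  fixes p q :: "complex poly"
  assumes deg: "degree p \<le> degree q" and nz: "\<And>w. w \<ge> 0 \<Longrightarrow> poly q (\<i> * of_real w) \<noteq> 0"
  shows "\<exists>c. \<forall>w\<ge>0. cmod (poly p (\<i> * of_real w) / poly q (\<i> * of_real w)) \<le> c"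
proof -
  define h where "h = (\<lambda>w. poly p (\<i> * complex_of_real w) / poly q (\<i> * of_real w))"
  define F where "F = (\<lambda>u. u ^ (degree q - degree p) * poly (reflect_poly p) u / poly (reflect_poly q) u)"
  have "q \<noteq> 0" using nz[of 0] by auto
  then have "isCont F 0" unfolding F_def by (intro continuous_intros) auto
  moreover have lim: "((\<lambda>w. inverse (\<i> * complex_of_real w)) \<longlongrightarrow> 0) at_top"
  proof (rule tendsto_norm_zero_cancel)
    show "((\<lambda>w. cmod (inverse (\<i> * complex_of_real w))) \<longlongrightarrow> 0) at_top"
      using tendsto_rabs_zero[OF tendsto_inverse_0_at_top[OF filterlim_ident]]
      by (simp add: norm_inverse norm_mult abs_inverse)
  qed
  ultimately have "((\<lambda>w. F (inverse (\<i> * complex_of_real w))) \<longlongrightarrow> F 0) at_top"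
    by (rule isCont_tendsto_compose)
  moreover have "eventually (\<lambda>w. F (inverse (\<i> * complex_of_real w)) = h w) at_top"
  proof (rule eventually_mono[OF eventually_gt_at_top[of 0]])
    fix w :: real assume "0 < w"
    then have nz': "inverse (\<i> * complex_of_real w) \<noteq> 0" by simp
    define u where "u = inverse (\<i> * complex_of_real w)"
    have "F u = u ^ (degree q - degree p) * u ^ degree p * poly p (\<i> * of_real w) /
        (u ^ degree q * poly q (\<i> * of_real w))"
      using nz' by (simp add: F_def poly_reflect_poly_nz u_def del: inverse_mult_distrib)
    also have "u ^ (degree q - degree p) * u ^ degree p = u ^ degree q"
      using deg by (simp flip: power_add)
    finally show "F (inverse (\<i> * complex_of_real w)) = h w"
      using nz' by (simp add: u_def h_def)
  qed
  ultimately have "(h \<longlongrightarrow> F 0) at_top" by (rule Lim_transform_eventually)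
  then have "eventually (\<lambda>w. dist (h w) (F 0) < 1) at_top" by (rule tendstoD) simp
  then obtain W where W: "\<And>w. w \<ge> W \<Longrightarrow> dist (h w) (F 0) < 1"
    by (auto simp: eventually_at_top_linorder)
  have "continuous_on {0..W} h"
    unfolding h_def using nz by (intro continuous_intros) auto
  then have "bounded (h ` {0..W})"
    by (intro compact_imp_bounded compact_continuous_image) auto
  then obtain b where b: "\<forall>z\<in>h ` {0..W}. cmod z \<le> b"
    unfolding bounded_iff by blast
  have "cmod (h w) \<le> max b (cmod (F 0) + 1)" if "w \<ge> 0" for w
  proof (cases "w \<le> W")
    case True
    then have "cmod (h w) \<le> b" using b that by force
    then show ?thesis by simp
  next
    case False
    then have "dist (h w) (F 0) < 1" using W by simp
    then show ?thesis using norm_triangle_ineq2[of "h w" "F 0"] by (simp add: dist_norm)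
  qed
  then show ?thesis unfolding h_def by blast
qed

lemma stable_proper_bounded:
  assumes "stable_proper f"
  shows "\<exists>c. \<forall>w\<ge>0. cmod (ratfun_eval f (\<i> * of_real w)) \<le> c"
proof -
  obtain a b where ab: "quot_of_fract f = (a, b)" by (cases "quot_of_fract f")
  have deg: "degree (map_poly complex_of_real x) = degree x" for x
    by (rule degree_map_poly) simp
  show ?thesis
    unfolding ratfun_eval_def ab Let_def prod.case
    using assms by (intro rational_bounded_imaginary_axis) (auto simp: stable_proper_def ab deg)
qed

text \<open>The value at infinity is a single matrix, so it has some bound, whether or not the limits defining
  its entries exist.\<close>

lemma at_freq_bounded:
  assumes "uniformly_bounded {0..} F"
  shows "uniformly_bounded {0..\<infinity>} (at_freq F)"
proof -
  from assms obtain c where c: "\<And>w. w \<ge> 0 \<Longrightarrow> norm_bound (F w) c"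
    by (auto simp: uniformly_bounded_def)
  obtain c' where c': "norm_bound (at_freq F \<infinity>) c'" using norm_bound_max by blast
  have mono: "norm_bound A (max c c')" if "norm_bound A c \<or> norm_bound A c'" for A :: "complex mat"
    using that unfolding norm_bound_def by (meson le_max_iff_disj)
  have "norm_bound (at_freq F \<omega>) (max c c')" if "\<omega> \<in> {0..\<infinity>}" for \<omega>
  proof (cases "\<omega> = \<infinity>")
    case True
    then show ?thesis using c' mono by blast
  next
    case False
    then have "norm_bound (at_freq F \<omega>) c"
      using that c[of "real_of_ereal \<omega>"] by (simp add: at_freq_def real_of_ereal_pos)
    then show ?thesis using mono by blast
  qed
  then show ?thesis unfolding uniformly_bounded_def by blast
qed

lemma at_freq_carrier:
  assumes "\<And>w. F w \<in> carrier_mat nr nc"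
  shows "at_freq F \<omega> \<in> carrier_mat nr nc"
  using assms[of 0] assms[of "real_of_ereal \<omega>"] by (simp add: at_freq_def)

text \<open>Conjugation is continuous, so Hermitian symmetry survives the limit; existence of the limit is needed
  to identify \<^const>\<open>Lim\<close>.\<close>

lemma at_freq_hermitian:
  assumes F: "\<And>w. F w \<in> carrier_mat n n" "\<And>w. hermitian (F w)"
    and conv: "\<And>i j. i < n \<Longrightarrow> j < n \<Longrightarrow> \<exists>l. ((\<lambda>w. F w $$ (i, j)) \<longlongrightarrow> l) at_top"
  shows "hermitian (at_freq F \<omega>)"
proof (cases "\<omega> = \<infinity>")
  case False
  then show ?thesis using F by (simp add: at_freq_def)
next
  case True
  let ?L = "\<lambda>i j. Lim at_top (\<lambda>w. F w $$ (i, j))"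
  have at: "at_freq F \<omega> = mat n n (\<lambda>(i, j). ?L i j)"
    using F(1)[of 0] True by (simp add: at_freq_def)
  have sym: "?L i j = cnj (?L j i)" if "i < n" "j < n" for i j
  proof -
    obtain l where l: "((\<lambda>w. F w $$ (j, i)) \<longlongrightarrow> l) at_top" using conv \<open>j < n\<close> \<open>i < n\<close> by blast
    have "F w $$ (i, j) = cnj (F w $$ (j, i))" for w
      using F that unfolding hermitian_iff by (metis carrier_matD(1))
    then have "((\<lambda>w. F w $$ (i, j)) \<longlongrightarrow> cnj l) at_top"
      using tendsto_cnj[OF l] by simp
    then show ?thesis using l by (simp add: tendsto_Lim)
  qed
  have "at_freq F \<omega> $$ (i, j) = cnj (at_freq F \<omega> $$ (j, i))" if ij: "i < n" "j < n" for i j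
    using ij sym[OF ij] unfolding at by (simp only: index_mat(1) prod.case)
  moreover have "dim_row (at_freq F \<omega>) = n" "square_mat (at_freq F \<omega>)" by (simp_all add: at)
  ultimately show ?thesis unfolding hermitian_iff by metis
qed

lemma bdiag_RH_inf:
  assumes "\<And>k. k < N \<Longrightarrow> G k \<in> RH_inf (r k) (c k)"
  shows "bdiag N G \<in> RH_inf (\<Sum>k<N. r k) (\<Sum>k<N. c k)"
proof -
  have car: "G k \<in> carrier_mat (r k) (c k)" if "k < N" for k
    using assms[OF that] by (simp add: RH_inf_def)
  note B = bdiag_carrier[of N G r c, OF car]
  have "stable_proper (bdiag N G $$ (i, j))" if "i < (\<Sum>k<N. r k)" "j < (\<Sum>k<N. c k)" for i j
  proof (rule bdiag_entries[where A = "\<lambda>_::unit. G" and P = "\<lambda>f. stable_proper (f ())", OF car _ _ that])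
    show "stable_proper 0" by (simp add: stable_proper_def)
    show "stable_proper (G k $$ (i, j))" if "k < N" "i < r k" "j < c k" for k i j
      using assms[OF that(1)] that elements_matI[OF car] by (auto simp: RH_inf_def)
  qed
  then show ?thesis using B by (auto simp: RH_inf_def)
qed

lemma tf_at_carrier: "G \<in> RH_inf nr nc \<Longrightarrow> tf_at G \<omega> \<in> carrier_mat nr nc"
  unfolding tf_at_def by (rule at_freq_carrier) (simp add: RH_inf_def freq_resp_def)

lemma tf_at_bounded:
  assumes G: "G \<in> RH_inf nr nc"
  shows "uniformly_bounded {0..\<infinity>} (tf_at G)"
  unfolding tf_at_def
proof (rule at_freq_bounded, rule uniformly_bounded_entrywise)
  have car: "G \<in> carrier_mat nr nc" using G by (simp add: RH_inf_def)
  then show "freq_resp G w \<in> carrier_mat nr nc" for w by (simp add: freq_resp_def)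
  fix i j assume ij: "i < nr" "j < nc"
  then have "stable_proper (G $$ (i, j))"
    using G elements_matI[OF car] by (auto simp: RH_inf_def)
  from stable_proper_bounded[OF this]
  show "\<exists>c. \<forall>w\<in>{0..}. cmod (freq_resp G w $$ (i, j)) \<le> c"
    using car ij by (auto simp: freq_resp_def)
qed

section \<open>Admissible multipliers\<close>

lemma blk_carrier [simp]: "blk n a b A \<in> carrier_mat n n"
  by (simp add: blk_def)

lemma blk_index: "a < 2 \<Longrightarrow> i < n \<Longrightarrow> a * n + i < n + (n::nat)"
  by (cases a) auto

text \<open>Block indices other than 0 and 1 would read outside of the matrix, hence the bounds on \<open>a\<close> and \<open>b\<close>.\<close>

lemma mat_adjoint_blk:
  assumes A: "A \<in> carrier_mat (n + n) (n + n)" "hermitian A" and ab: "a < 2" "b < 2"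
  shows "mat_adjoint (blk n a b A) = blk n b a A"
proof (rule eq_matI)
  fix i j assume "i < dim_row (blk n b a A)" "j < dim_col (blk n b a A)"
  then have ij: "i < n" "j < n" by (simp_all add: blk_def)
  have "A $$ (b * n + i, a * n + j) = cnj (A $$ (a * n + j, b * n + i))"
    using A blk_index[OF ab(2) ij(1)] blk_index[OF ab(1) ij(2)]
    unfolding hermitian_iff by (metis carrier_matD(1))
  then show "mat_adjoint (blk n a b A) $$ (i, j) = blk n b a A $$ (i, j)"
    using ij by (simp add: blk_def)
qed (simp_all add: blk_def)

lemma diag_mult_carrier: "diag_mult N d \<Phi> w \<in> carrier_mat ((\<Sum>i<N. d i) + (\<Sum>i<N. d i)) ((\<Sum>i<N. d i) + (\<Sum>i<N. d i))"
proof -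
  have "bdiag N (\<lambda>i. blk (d i) a b (\<Phi> i w)) \<in> carrier_mat (\<Sum>i<N. d i) (\<Sum>i<N. d i)" for a b
    by (rule bdiag_carrier) simp
  then show ?thesis unfolding diag_mult_def Let_def by (intro four_block_carrier_mat)
qed

lemma diag_mult_hermitian:
  assumes "\<And>i. i < N \<Longrightarrow> multiplier (d i) (\<Phi> i)"
  shows "hermitian (diag_mult N d \<Phi> w)"
proof -
  let ?D = "\<Sum>i<N. d i" and ?B = "\<lambda>a b. bdiag N (\<lambda>i. blk (d i) a b (\<Phi> i w))"
  have car: "?B a b \<in> carrier_mat ?D ?D" for a b by (rule bdiag_carrier) simp
  have adj: "mat_adjoint (?B a b) = ?B b a" if "a < 2" "b < 2" for a b
  proof -
    have "mat_adjoint (?B a b) = bdiag N (\<lambda>i. mat_adjoint (blk (d i) a b (\<Phi> i w)))"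
      by (rule mat_adjoint_bdiag[where r = d and c = d]) simp
    also have "\<dots> = ?B b a"
      using assms that unfolding bdiag_def
      by (intro arg_cong[of _ _ diag_block_mat] map_cong refl mat_adjoint_blk) (auto simp: multiplier_def)
    finally show ?thesis .
  qed
  have "mat_adjoint (diag_mult N d \<Phi> w) = diag_mult N d \<Phi> w"
    unfolding diag_mult_def Let_def mat_adjoint_four_block[OF car car car car] by (simp add: adj)
  then show ?thesis using diag_mult_carrier[of N d \<Phi> w] by (simp add: hermitian_def)
qed

lemma diag_mult_entries:
  assumes "\<And>k. k < N \<Longrightarrow> multiplier (d k) (\<Phi> k)"
    and "i < (\<Sum>k<N. d k) + (\<Sum>k<N. d k)" "j < (\<Sum>k<N. d k) + (\<Sum>k<N. d k)"
  shows "(\<exists>l. ((\<lambda>w. diag_mult N d \<Phi> w $$ (i, j)) \<longlongrightarrow> l) at_top) \<and>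
    (\<exists>c. \<forall>w. cmod (diag_mult N d \<Phi> w $$ (i, j)) \<le> c)"
proof -
  let ?D = "\<Sum>k<N. d k" and ?B = "\<lambda>a b w. bdiag N (\<lambda>k. blk (d k) a b (\<Phi> k w))"
  let ?P = "\<lambda>g :: real \<Rightarrow> complex. (\<exists>l. (g \<longlongrightarrow> l) at_top) \<and> (\<exists>c. \<forall>w. cmod (g w) \<le> c)"
  have car: "?B a b w \<in> carrier_mat ?D ?D" for a b w by (rule bdiag_carrier) simp
  have block: "?P (\<lambda>w. ?B a b w $$ (i, j))" if ab: "a < 2" "b < 2" and ij: "i < ?D" "j < ?D" for a b i j
  proof (rule bdiag_entries[where r = d and c = d and P = ?P])
    show "?P (\<lambda>_. 0)" by auto
    fix k i j assume k: "k < N" and ij: "i < d k" "j < d k"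
    have idx: "a * d k + i < d k + d k" "b * d k + j < d k + d k"
      using blk_index ab ij by auto
    have m: "multiplier (d k) (\<Phi> k)" using assms(1) k .
    obtain c where c: "\<And>w. norm_bound (\<Phi> k w) c" using m unfolding multiplier_def by blast
    have carP: "\<Phi> k w \<in> carrier_mat (d k + d k) (d k + d k)" for w using m by (simp add: multiplier_def)
    have "cmod (\<Phi> k w $$ (a * d k + i, b * d k + j)) \<le> c" for w
      using c[of w] carP[of w] idx by (simp add: norm_bound_def)
    moreover have "\<exists>l. ((\<lambda>w. \<Phi> k w $$ (a * d k + i, b * d k + j)) \<longlongrightarrow> l) at_top"
      using m idx unfolding multiplier_def by blast
    ultimately show "?P (\<lambda>w. blk (d k) a b (\<Phi> k w) $$ (i, j))" using ij by (auto simp: blk_def)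
  qed (use ij in simp_all)
  have idx: "diag_mult N d \<Phi> w $$ (i, j) =
      (if i < ?D then if j < ?D then ?B 0 0 w $$ (i, j) else ?B 0 1 w $$ (i, j - ?D)
       else if j < ?D then ?B 1 0 w $$ (i - ?D, j) else ?B 1 1 w $$ (i - ?D, j - ?D))" for w
    using car[of 0 0 w] car[of 1 1 w] assms(2,3) by (simp add: diag_mult_def Let_def)
  show ?thesis
    unfolding idx using assms(2,3) block by (cases "i < ?D"; cases "j < ?D") simp_all
qed

lemma admissible_at_freq:
  assumes "\<Phi> \<in> admissible N d \<Delta>"
  defines "D \<equiv> \<Sum>i<N. d i"
  shows "at_freq \<Phi> \<omega> \<in> carrier_mat (D + D) (D + D)"
    and "hermitian (at_freq \<Phi> \<omega>)"
    and "uniformly_bounded {0..\<infinity>} (at_freq \<Phi>)"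
proof -
  from assms obtain \<Psi> where \<Phi>: "\<Phi> = diag_mult N d \<Psi>" and \<Psi>: "\<And>i. i < N \<Longrightarrow> multiplier (d i) (\<Psi> i)"
    unfolding admissible_def by blast
  have car: "\<Phi> w \<in> carrier_mat (D + D) (D + D)" for w
    unfolding \<Phi> D_def by (rule diag_mult_carrier)
  note entries = diag_mult_entries[where N = N and d = d and \<Phi> = \<Psi>, OF \<Psi>, folded \<Phi> D_def]
  show "at_freq \<Phi> \<omega> \<in> carrier_mat (D + D) (D + D)" by (rule at_freq_carrier[OF car])
  show "hermitian (at_freq \<Phi> \<omega>)"
  proof (rule at_freq_hermitian[OF car])
    show "hermitian (\<Phi> w)" for w unfolding \<Phi> by (rule diag_mult_hermitian[OF \<Psi>])
    show "\<exists>l. ((\<lambda>w. \<Phi> w $$ (i, j)) \<longlongrightarrow> l) at_top" if "i < D + D" "j < D + D" for i j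
      using entries[OF _ that] by blast
  qed
  show "uniformly_bounded {0..\<infinity>} (at_freq \<Phi>)"
  proof (intro at_freq_bounded uniformly_bounded_entrywise)
    show "\<Phi> w \<in> carrier_mat (D + D) (D + D)" for w by (rule car)
    show "\<exists>c. \<forall>w\<in>{0..}. cmod (\<Phi> w $$ (i, j)) \<le> c" if "i < D + D" "j < D + D" for i j
      using entries[OF _ that] by blast
  qed
qed

section \<open>Eliminating the interconnection\<close>

lemma minv_inverse:
  assumes A: "A \<in> carrier_mat n n" and inv: "invertible_mat A"
  shows "minv A \<in> carrier_mat n n" "A * minv A = 1\<^sub>m n" "minv A * A = 1\<^sub>m n"
proof -
  from inv obtain B where B: "A * B = 1\<^sub>m (dim_row A)" "B * A = 1\<^sub>m (dim_row B)"
    unfolding invertible_mat_def inverts_mat_def by blast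
  have "dim_row B = n" "dim_col B = n"
    using A arg_cong[OF B(1), of dim_col] arg_cong[OF B(2), of dim_col] by auto
  then have "B \<in> carrier_mat n n" by (intro carrier_matI)
  then have "A \<in> Units (ring_mat TYPE(complex) n ())"
    using A B unfolding Units_def by (auto simp: ring_mat_simps)
  then obtain C where "mat_inverse A = Some C"
    using mat_inverse(1)[OF A, where b = "()"] by (cases "mat_inverse A") auto
  then show "minv A \<in> carrier_mat n n" "A * minv A = 1\<^sub>m n" "minv A * A = 1\<^sub>m n"
    using mat_inverse(2)[OF A] by (auto simp: minv_def)
qed

text \<open>Factoring out \<open>S\<close> exhibits the kernel of the residual as the graph of \<open>T C Z\<close>. The two blocks without
  rows only serve to place the other two side by side.\<close>

lemma interconnection_residual:
  fixes S T C ZQ :: "complex mat"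
  assumes C: "C \<in> carrier_mat m l" and ZQ: "ZQ \<in> carrier_mat l d"
    and S: "S \<in> carrier_mat m m" and T: "T \<in> carrier_mat m m" and ST: "S * T = 1\<^sub>m m"
    and x: "x \<in> carrier_vec d" and y: "y \<in> carrier_vec m"
  shows "four_block_mat (- (C * ZQ)) S (0\<^sub>m 0 d) (0\<^sub>m 0 m) *\<^sub>v (x @\<^sub>v y) =
    S *\<^sub>v (y - (T * (C * ZQ)) *\<^sub>v x)"
proof -
  have CZ: "C * ZQ \<in> carrier_mat m d" using C ZQ by (rule mult_carrier_mat)
  have TCZ: "T * (C * ZQ) \<in> carrier_mat m d" using T CZ by (rule mult_carrier_mat)
  have Kx: "(T * (C * ZQ)) *\<^sub>v x \<in> carrier_vec m" using TCZ x by (rule mult_mat_vec_carrier)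
  have Sy: "S *\<^sub>v y \<in> carrier_vec m" using S y by (rule mult_mat_vec_carrier)
  have CZx: "(C * ZQ) *\<^sub>v x \<in> carrier_vec m" using CZ x by (rule mult_mat_vec_carrier)
  have "S *\<^sub>v ((T * (C * ZQ)) *\<^sub>v x) = (S * (T * (C * ZQ))) *\<^sub>v x"
    by (rule assoc_mult_mat_vec[OF S TCZ x, symmetric])
  also have "S * (T * (C * ZQ)) = (S * T) * (C * ZQ)"
    by (rule assoc_mult_mat[OF S T CZ, symmetric])
  also have "\<dots> = C * ZQ" unfolding ST by (rule left_mult_one_mat[OF CZ])
  finally have SK: "S *\<^sub>v ((T * (C * ZQ)) *\<^sub>v x) = (C * ZQ) *\<^sub>v x" .
  have neg: "- (C * ZQ) *\<^sub>v x = - ((C * ZQ) *\<^sub>v x)"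
    by (rule uminus_mult_mat_vec) (use ZQ x in simp)
  have "four_block_mat (- (C * ZQ)) S (0\<^sub>m 0 d) (0\<^sub>m 0 m) *\<^sub>v (x @\<^sub>v y) =
      (- (C * ZQ) *\<^sub>v x + S *\<^sub>v y) @\<^sub>v (0\<^sub>m 0 d *\<^sub>v x + 0\<^sub>m 0 m *\<^sub>v y)"
    by (rule four_block_mat_mult_vec[OF uminus_carrier_mat[OF CZ] S zero_carrier_mat zero_carrier_mat x y])
  also have "\<dots> = - (C * ZQ) *\<^sub>v x + S *\<^sub>v y"
    by (intro eq_vecI) auto
  also have "\<dots> = S *\<^sub>v y - (C * ZQ) *\<^sub>v x"
    unfolding neg using Sy CZx by (simp add: comm_add_vec[of _ m] minus_add_uminus_vec[of _ m])
  also have "\<dots> = S *\<^sub>v (y - (T * (C * ZQ)) *\<^sub>v x)"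
    unfolding mult_minus_distrib_mat_vec[OF S y Kx] SK ..
  finally show ?thesis .
qed

text \<open>On the solutions \<open>w = K q\<close> of the interconnection equations the network looks like the lumped system.\<close>

lemma closed_loop_elimination:
  fixes PQ PW K :: "complex mat"
  assumes PQ: "PQ \<in> carrier_mat d d" and PW: "PW \<in> carrier_mat d m" and K: "K \<in> carrier_mat m d"
    and x: "x \<in> carrier_vec d"
  shows "four_block_mat PQ PW (1\<^sub>m d) (0\<^sub>m d m) *\<^sub>v (x @\<^sub>v K *\<^sub>v x) =
    ((PQ + PW * K) @\<^sub>r 1\<^sub>m d) *\<^sub>v x"
proof -
  have Kx: "K *\<^sub>v x \<in> carrier_vec m" using K x by (rule mult_mat_vec_carrier)
  have PWK: "PW * K \<in> carrier_mat d d" using PW K by (rule mult_carrier_mat)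
  have "four_block_mat PQ PW (1\<^sub>m d) (0\<^sub>m d m) *\<^sub>v (x @\<^sub>v K *\<^sub>v x) =
      (PQ *\<^sub>v x + PW *\<^sub>v (K *\<^sub>v x)) @\<^sub>v (1\<^sub>m d *\<^sub>v x + 0\<^sub>m d m *\<^sub>v (K *\<^sub>v x))"
    by (rule four_block_mat_mult_vec[OF PQ PW one_carrier_mat zero_carrier_mat x Kx])
  also have "PQ *\<^sub>v x + PW *\<^sub>v (K *\<^sub>v x) = (PQ + PW * K) *\<^sub>v x"
    unfolding add_mult_distrib_mat_vec[OF PQ PWK x] assoc_mult_mat_vec[OF PW K x] ..
  also have "1\<^sub>m d *\<^sub>v x + 0\<^sub>m d m *\<^sub>v (K *\<^sub>v x) = 1\<^sub>m d *\<^sub>v x"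
    using x Kx by (intro eq_vecI) auto
  also have "((PQ + PW * K) *\<^sub>v x) @\<^sub>v (1\<^sub>m d *\<^sub>v x) = ((PQ + PW * K) @\<^sub>r 1\<^sub>m d) *\<^sub>v x"
    by (rule mat_mult_append[symmetric, OF add_carrier_mat[OF PWK] one_carrier_mat x])
  finally show ?thesis .
qed

text \<open>The interconnection matrix is real, so its transpose is its adjoint and the two outer factors around
  \<open>X\<close> are adjoint to each other.\<close>

lemma mat_adjoint_residual:
  fixes ZQ ZW :: "complex mat"
  assumes \<Gamma>: "\<Gamma> \<in> carrier_mat m l" and ZQ: "ZQ \<in> carrier_mat l d" and ZW: "ZW \<in> carrier_mat l m"
  defines "C \<equiv> cplx_mat \<Gamma>"
  shows "(- (mat_adjoint ZQ * C\<^sup>T)) @\<^sub>r (1\<^sub>m m - mat_adjoint ZW * C\<^sup>T) =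
    mat_adjoint (four_block_mat (- (C * ZQ)) (1\<^sub>m m - C * ZW) (0\<^sub>m 0 d) (0\<^sub>m 0 m))"
proof -
  have C: "C \<in> carrier_mat m l" using \<Gamma> by (simp add: C_def cplx_mat_def)
  have adjC: "mat_adjoint C = C\<^sup>T"
    using \<Gamma> by (intro eq_matI) (auto simp: C_def cplx_mat_def)
  have CQ: "C * ZQ \<in> carrier_mat m d" using C ZQ by (rule mult_carrier_mat)
  have CW: "C * ZW \<in> carrier_mat m m" using C ZW by (rule mult_carrier_mat)
  have one: "mat_adjoint (1\<^sub>m m) = (1\<^sub>m m :: complex mat)" by (intro eq_matI) auto
  have Q: "mat_adjoint (- (C * ZQ)) = - (mat_adjoint ZQ * C\<^sup>T)"
    unfolding adjC[symmetric] mat_adjoint_mult[OF C ZQ, symmetric] by (intro eq_matI) auto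
  have W: "mat_adjoint (1\<^sub>m m - C * ZW) = 1\<^sub>m m - mat_adjoint ZW * C\<^sup>T"
    unfolding mat_adjoint_minus[OF one_carrier_mat CW] mat_adjoint_mult[OF C ZW] one adjC ..
  show ?thesis
    unfolding append_rows_def
    by (subst mat_adjoint_four_block[OF uminus_carrier_mat[OF CQ] minus_carrier_mat[OF CW] zero_carrier_mat zero_carrier_mat])
      (use C ZQ ZW in \<open>simp add: Q W mat_adjoint_zero\<close>)
qed

section \<open>Equivalence of the distributed and the lumped condition\<close>

theorem theorem2:
  fixes N :: nat and d m l :: "nat \<Rightarrow> nat"
    and Gpq' Gpw' Gzq' Gzw' :: "nat \<Rightarrow> tfmat"
    and Gpq Gpw Gzq Gzw :: tfmat
    and \<Gamma> :: "real mat" and \<Delta> :: "nat \<Rightarrow> signal \<Rightarrow> signal"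
    and dd mm ll :: nat
  assumes dims: "dd = (\<Sum>i<N. d i)" "mm = (\<Sum>i<N. m i)" "ll = (\<Sum>i<N. l i)"
    and subsystems: "\<And>i. i < N \<Longrightarrow> Gpq' i \<in> RH_inf (d i) (d i)"
      "\<And>i. i < N \<Longrightarrow> Gpw' i \<in> RH_inf (d i) (m i)"
      "\<And>i. i < N \<Longrightarrow> Gzq' i \<in> RH_inf (l i) (d i)"
      "\<And>i. i < N \<Longrightarrow> Gzw' i \<in> RH_inf (l i) (m i)"
    and blocks: "Gpq = bdiag N Gpq'" "Gpw = bdiag N Gpw'" "Gzq = bdiag N Gzq'" "Gzw = bdiag N Gzw'"
    and uncertainty: "\<And>i. i < N \<Longrightarrow> bounded_causal (d i) (\<Delta> i)"
    and interconnection: "\<Gamma> \<in> carrier_mat mm ll" "elements_mat \<Gamma> \<subseteq> {0, 1}"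
    and inverse: "has_bounded_inverse (\<lambda>\<omega>. 1\<^sub>m mm - cplx_mat \<Gamma> * tf_at Gzw \<omega>)"
    and wellposed: "\<And>\<tau>. \<tau> \<in> {0..1} \<Longrightarrow>
      well_posed dd mm ll Gpq Gpw Gzq Gzw \<Gamma> (scale_op \<tau> (diag_op N d \<Delta>))"
  shows
    "(\<exists>\<Phi> \<in> admissible N d \<Delta>. \<exists>X \<in> carrier_mat mm mm. \<exists>\<epsilon>::real. pos_def X \<and> \<epsilon> > 0 \<and>
       (\<forall>\<omega> \<in> {0..\<infinity>}.
          let PQ = tf_at Gpq \<omega>; PW = tf_at Gpw \<omega>; ZQ = tf_at Gzq \<omega>; ZW = tf_at Gzw \<omega>;
              C = cplx_mat \<Gamma>;
              M = four_block_mat PQ PW (1\<^sub>m dd) (0\<^sub>m dd mm)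
          in loewner_le (dd + mm)
               (mat_adjoint M * at_freq \<Phi> \<omega> * M -
                 ((- (mat_adjoint ZQ * C\<^sup>T)) @\<^sub>r (1\<^sub>m mm - mat_adjoint ZW * C\<^sup>T)) * X *
                   four_block_mat (- (C * ZQ)) (1\<^sub>m mm - C * ZW) (0\<^sub>m 0 dd) (0\<^sub>m 0 mm))
               (- complex_of_real \<epsilon> \<cdot>\<^sub>m 1\<^sub>m (dd + mm))))
     \<longleftrightarrow>
     (\<exists>\<Phi> \<in> admissible N d \<Delta>. \<exists>\<epsilon>::real. \<epsilon> > 0 \<and>
       (\<forall>\<omega> \<in> {0..\<infinity>}.
          let M = lumped Gpq Gpw Gzq Gzw \<Gamma> \<omega> @\<^sub>r 1\<^sub>m dd
          in loewner_le dd (mat_adjoint M * at_freq \<Phi> \<omega> * M) (- complex_of_real \<epsilon> \<cdot>\<^sub>m 1\<^sub>m dd)))"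
proof (rule bex_cong[OF refl])
  fix \<Phi> assume \<Phi>: "\<Phi> \<in> admissible N d \<Delta>"
  let ?I = "{0..\<infinity>} :: ereal set"
  define C where "C = cplx_mat \<Gamma>"
  define PQ PW ZQ ZW where "PQ = tf_at Gpq" and "PW = tf_at Gpw" and "ZQ = tf_at Gzq" and "ZW = tf_at Gzw"
  define S where "S = (\<lambda>\<omega>. 1\<^sub>m mm - C * ZW \<omega>)"
  define T where "T = (\<lambda>\<omega>. minv (S \<omega>))"
  define K where "K = (\<lambda>\<omega>. T \<omega> * (C * ZQ \<omega>))"
  define M where "M = (\<lambda>\<omega>. four_block_mat (PQ \<omega>) (PW \<omega>) (1\<^sub>m dd) (0\<^sub>m dd mm))"
  define R where "R = (\<lambda>\<omega>. four_block_mat (- (C * ZQ \<omega>)) (S \<omega>) (0\<^sub>m 0 dd) (0\<^sub>m 0 mm))"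
  define Q where "Q = (\<lambda>\<omega>. mat_adjoint (M \<omega>) * at_freq \<Phi> \<omega> * M \<omega>)"
  define L where "L = (\<lambda>\<omega>. lumped Gpq Gpw Gzq Gzw \<Gamma> \<omega> @\<^sub>r 1\<^sub>m dd)"

  have RH: "Gpq \<in> RH_inf dd dd" "Gpw \<in> RH_inf dd mm" "Gzq \<in> RH_inf ll dd" "Gzw \<in> RH_inf ll mm"
    unfolding blocks dims using subsystems by (auto intro!: bdiag_RH_inf)
  have PQ: "PQ \<omega> \<in> carrier_mat dd dd" and PW: "PW \<omega> \<in> carrier_mat dd mm"
    and ZQ: "ZQ \<omega> \<in> carrier_mat ll dd" and ZW: "ZW \<omega> \<in> carrier_mat ll mm" for \<omega>
    unfolding PQ_def PW_def ZQ_def ZW_def using RH by (auto intro: tf_at_carrier)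
  have C: "C \<in> carrier_mat mm ll" using interconnection(1) by (simp add: C_def cplx_mat_def)
  have CZQ: "C * ZQ \<omega> \<in> carrier_mat mm dd" for \<omega> using C ZQ by (rule mult_carrier_mat)
  have S: "S \<omega> \<in> carrier_mat mm mm" for \<omega>
    unfolding S_def by (rule minus_carrier_mat[OF mult_carrier_mat[OF C ZW]])
  have inv: "has_bounded_inverse S" using inverse unfolding S_def C_def ZW_def .
  then have S_inv: "invertible_mat (S \<omega>)" if "\<omega> \<in> ?I" for \<omega>
    using that unfolding has_bounded_inverse_def by blast
  have T: "T \<omega> \<in> carrier_mat mm mm" "S \<omega> * T \<omega> = 1\<^sub>m mm" "T \<omega> * S \<omega> = 1\<^sub>m mm" if "\<omega> \<in> ?I" for \<omega>
    unfolding T_def by (fact minv_inverse[OF S S_inv[OF that]])+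
  have T_bd: "uniformly_bounded ?I T"
    using inv unfolding has_bounded_inverse_def uniformly_bounded_def T_def by blast
  have K: "K \<omega> \<in> carrier_mat mm dd" if "\<omega> \<in> ?I" for \<omega>
    unfolding K_def using T(1)[OF that] CZQ by (rule mult_carrier_mat)
  have K_bd: "uniformly_bounded ?I K"
    unfolding K_def ZQ_def
    by (intro uniformly_bounded_mult[OF T(1) T_bd CZQ[unfolded ZQ_def]]
        uniformly_bounded_mult[OF C uniformly_bounded_const tf_at_carrier[OF RH(3)] tf_at_bounded[OF RH(3)]])
  have M: "M \<omega> \<in> carrier_mat (dd + dd) (dd + mm)" for \<omega>
    unfolding M_def by (rule four_block_carrier_mat[OF PQ zero_carrier_mat])
  have M_bd: "uniformly_bounded ?I M"
    unfolding M_def PQ_def PW_def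
    by (rule uniformly_bounded_four_block[OF tf_at_carrier[OF RH(1)] tf_at_carrier[OF RH(2)]
        one_carrier_mat zero_carrier_mat tf_at_bounded[OF RH(1)] tf_at_bounded[OF RH(2)]
        uniformly_bounded_const uniformly_bounded_const])
  note F = admissible_at_freq[OF \<Phi>, folded dims(1)]
  have MF: "mat_adjoint (M \<omega>) * at_freq \<Phi> \<omega> \<in> carrier_mat (dd + mm) (dd + dd)" for \<omega>
    by (rule mult_carrier_mat[OF mat_adjoint_carrier[OF M] F(1)])
  have Q: "Q \<omega> \<in> carrier_mat (dd + mm) (dd + mm)" for \<omega>
    unfolding Q_def by (rule mult_carrier_mat[OF MF M])
  have Q_herm: "hermitian (Q \<omega>)" for \<omega>
    unfolding Q_def by (rule hermitian_congruence[OF M F(1,2)])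
  have Q_bd: "uniformly_bounded ?I Q"
    unfolding Q_def
    by (rule uniformly_bounded_mult[OF MF uniformly_bounded_mult[OF mat_adjoint_carrier[OF M]
        uniformly_bounded_adjoint[OF M_bd] F(1,3)] M M_bd])
  have R: "R \<omega> \<in> carrier_mat mm (dd + mm)" for \<omega>
    using four_block_carrier_mat[OF uminus_carrier_mat[OF CZQ[of \<omega>]] zero_carrier_mat[of 0 mm]]
    by (simp add: R_def)
  have residual: "R \<omega> *\<^sub>v (x @\<^sub>v y) = S \<omega> *\<^sub>v (y - K \<omega> *\<^sub>v x)"
    if "\<omega> \<in> ?I" "x \<in> carrier_vec dd" "y \<in> carrier_vec mm" for \<omega> x y
    unfolding R_def K_def by (rule interconnection_residual[OF C ZQ S T(1,2)[OF that(1)] that(2,3)])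

  have lumped: "lumped Gpq Gpw Gzq Gzw \<Gamma> \<omega> = PQ \<omega> + PW \<omega> * K \<omega>" if "\<omega> \<in> ?I" for \<omega>
  proof -
    note t = T(1)[OF that]
    have "lumped Gpq Gpw Gzq Gzw \<Gamma> \<omega> = PQ \<omega> + PW \<omega> * T \<omega> * C * ZQ \<omega>"
      using interconnection(1)
      by (simp add: lumped_def PQ_def PW_def ZQ_def T_def S_def ZW_def C_def)
    also have "PW \<omega> * T \<omega> * C * ZQ \<omega> = PW \<omega> * T \<omega> * (C * ZQ \<omega>)"
      by (rule assoc_mult_mat[OF mult_carrier_mat[OF PW t] C ZQ])
    also have "\<dots> = PW \<omega> * K \<omega>"
      unfolding K_def by (rule assoc_mult_mat[OF PW t CZQ])
    finally show ?thesis .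
  qed
  have L: "L \<omega> \<in> carrier_mat (dd + dd) dd" if "\<omega> \<in> ?I" for \<omega>
    unfolding L_def lumped[OF that] using mult_carrier_mat[OF PW K[OF that]]
    by (intro carrier_append_rows add_carrier_mat one_carrier_mat)
  have elim: "M \<omega> *\<^sub>v (x @\<^sub>v K \<omega> *\<^sub>v x) = L \<omega> *\<^sub>v x" if "\<omega> \<in> ?I" "x \<in> carrier_vec dd" for \<omega> x
    unfolding M_def L_def lumped[OF that(1)]
    by (rule closed_loop_elimination[OF PQ PW K[OF that(1)] that(2)])

  have lmi_a: "loewner_le (dd + mm)
        (Q \<omega> - ((- (mat_adjoint (ZQ \<omega>) * C\<^sup>T)) @\<^sub>r (1\<^sub>m mm - mat_adjoint (ZW \<omega>) * C\<^sup>T)) * X * R \<omega>)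
        (- complex_of_real \<epsilon> \<cdot>\<^sub>m 1\<^sub>m (dd + mm)) \<longleftrightarrow>
      (\<forall>v\<in>carrier_vec (dd + mm). Re ((Q \<omega> *\<^sub>v v) \<bullet>c v) -
        Re ((X *\<^sub>v (R \<omega> *\<^sub>v v)) \<bullet>c (R \<omega> *\<^sub>v v)) \<le> - \<epsilon> * sqnorm v)"
    if X: "X \<in> carrier_mat mm mm" "pos_def X" for X \<omega> and \<epsilon> :: real
  proof -
    have herm: "hermitian X" using X(2) by (simp add: pos_def_def)
    have adj: "(- (mat_adjoint (ZQ \<omega>) * C\<^sup>T)) @\<^sub>r (1\<^sub>m mm - mat_adjoint (ZW \<omega>) * C\<^sup>T) = mat_adjoint (R \<omega>)"
      unfolding R_def S_def C_def by (rule mat_adjoint_residual[OF interconnection(1) ZQ ZW])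
    let ?B = "mat_adjoint (R \<omega>) * X * R \<omega>"
    have B: "?B \<in> carrier_mat (dd + mm) (dd + mm)"
      by (rule mult_carrier_mat[OF mult_carrier_mat[OF mat_adjoint_carrier[OF R] X(1)] R])
    have "Re (((Q \<omega> - ?B) *\<^sub>v v) \<bullet>c v) =
        Re ((Q \<omega> *\<^sub>v v) \<bullet>c v) - Re ((X *\<^sub>v (R \<omega> *\<^sub>v v)) \<bullet>c (R \<omega> *\<^sub>v v))"
      if v: "v \<in> carrier_vec (dd + mm)" for v
      unfolding minus_mult_distrib_mat_vec[OF Q B v]
        minus_scalar_prod_distrib[OF mult_mat_vec_carrier[OF Q v] mult_mat_vec_carrier[OF B v] carrier_vec_conjugate[OF v]]
        congruence_form[OF R X(1) v] by simp
    then show ?thesis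
      unfolding adj
      using loewner_le_neg_iff[OF minus_carrier_mat[OF B] hermitian_minus[OF Q B Q_herm hermitian_congruence[OF R X(1) herm]]]
      by simp
  qed
  have lmi_b: "loewner_le dd (mat_adjoint (L \<omega>) * at_freq \<Phi> \<omega> * L \<omega>) (- complex_of_real \<epsilon> \<cdot>\<^sub>m 1\<^sub>m dd) \<longleftrightarrow>
      (\<forall>x\<in>carrier_vec dd. Re ((Q \<omega> *\<^sub>v (x @\<^sub>v K \<omega> *\<^sub>v x)) \<bullet>c (x @\<^sub>v K \<omega> *\<^sub>v x)) \<le> - \<epsilon> * sqnorm x)"
    if \<omega>: "\<omega> \<in> ?I" for \<omega> and \<epsilon> :: real
  proof -
    have "((mat_adjoint (L \<omega>) * at_freq \<Phi> \<omega> * L \<omega>) *\<^sub>v x) \<bullet>c x =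
        (Q \<omega> *\<^sub>v (x @\<^sub>v K \<omega> *\<^sub>v x)) \<bullet>c (x @\<^sub>v K \<omega> *\<^sub>v x)"
      if x: "x \<in> carrier_vec dd" for x
      unfolding Q_def congruence_form[OF L[OF \<omega>] F(1) x]
        congruence_form[OF M F(1) append_carrier_vec[OF x mult_mat_vec_carrier[OF K[OF \<omega>] x]]]
        elim[OF \<omega> x] ..
    then show ?thesis
      using loewner_le_neg_iff[OF mult_carrier_mat[OF mult_carrier_mat[OF mat_adjoint_carrier[OF L[OF \<omega>]] F(1)] L[OF \<omega>]]
          hermitian_congruence[OF L[OF \<omega>] F(1,2)]]
      by simp
  qed
  \<comment> \<open>Both inequalities now speak about the form of \<open>Q\<close> on all vectors and on the graph of \<open>K\<close>.\<close>
  note finsler = uniform_finsler[of ?I Q dd mm K T S R, OF Q Q_herm Q_bd K K_bd T(1) T_bd S T(3) residual]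
  have "(\<exists>X\<in>carrier_mat mm mm. \<exists>\<epsilon>::real. pos_def X \<and> \<epsilon> > 0 \<and> (\<forall>\<omega>\<in>?I. loewner_le (dd + mm)
        (Q \<omega> - ((- (mat_adjoint (ZQ \<omega>) * C\<^sup>T)) @\<^sub>r (1\<^sub>m mm - mat_adjoint (ZW \<omega>) * C\<^sup>T)) * X * R \<omega>)
        (- complex_of_real \<epsilon> \<cdot>\<^sub>m 1\<^sub>m (dd + mm)))) \<longleftrightarrow>
      (\<exists>X\<in>carrier_mat mm mm. \<exists>\<epsilon>>0. pos_def X \<and> (\<forall>\<omega>\<in>?I. \<forall>v\<in>carrier_vec (dd + mm).
        Re ((Q \<omega> *\<^sub>v v) \<bullet>c v) - Re ((X *\<^sub>v (R \<omega> *\<^sub>v v)) \<bullet>c (R \<omega> *\<^sub>v v)) \<le> - \<epsilon> * sqnorm v))"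
  proof (intro bex_cong refl iff_exI)
    fix X :: "complex mat" and \<epsilon> :: real assume X: "X \<in> carrier_mat mm mm"
    show "(pos_def X \<and> \<epsilon> > 0 \<and> (\<forall>\<omega>\<in>?I. loewner_le (dd + mm)
        (Q \<omega> - ((- (mat_adjoint (ZQ \<omega>) * C\<^sup>T)) @\<^sub>r (1\<^sub>m mm - mat_adjoint (ZW \<omega>) * C\<^sup>T)) * X * R \<omega>)
        (- complex_of_real \<epsilon> \<cdot>\<^sub>m 1\<^sub>m (dd + mm)))) \<longleftrightarrow>
      (0 < \<epsilon> \<and> pos_def X \<and> (\<forall>\<omega>\<in>?I. \<forall>v\<in>carrier_vec (dd + mm).
        Re ((Q \<omega> *\<^sub>v v) \<bullet>c v) - Re ((X *\<^sub>v (R \<omega> *\<^sub>v v)) \<bullet>c (R \<omega> *\<^sub>v v)) \<le> - \<epsilon> * sqnorm v))"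
      using lmi_a[OF X] by blast
  qed
  also note finsler
  also have "(\<exists>\<epsilon>>0. \<forall>\<omega>\<in>?I. \<forall>x\<in>carrier_vec dd.
        Re ((Q \<omega> *\<^sub>v (x @\<^sub>v K \<omega> *\<^sub>v x)) \<bullet>c (x @\<^sub>v K \<omega> *\<^sub>v x)) \<le> - \<epsilon> * sqnorm x) \<longleftrightarrow>
      (\<exists>\<epsilon>::real. \<epsilon> > 0 \<and> (\<forall>\<omega>\<in>?I.
        loewner_le dd (mat_adjoint (L \<omega>) * at_freq \<Phi> \<omega> * L \<omega>) (- complex_of_real \<epsilon> \<cdot>\<^sub>m 1\<^sub>m dd)))"
    using lmi_b by blast
  finally show "(\<exists>X \<in> carrier_mat mm mm. \<exists>\<epsilon>::real. pos_def X \<and> \<epsilon> > 0 \<and>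
       (\<forall>\<omega> \<in> {0..\<infinity>}.
          let PQ = tf_at Gpq \<omega>; PW = tf_at Gpw \<omega>; ZQ = tf_at Gzq \<omega>; ZW = tf_at Gzw \<omega>;
              C = cplx_mat \<Gamma>;
              M = four_block_mat PQ PW (1\<^sub>m dd) (0\<^sub>m dd mm)
          in loewner_le (dd + mm)
               (mat_adjoint M * at_freq \<Phi> \<omega> * M -
                 ((- (mat_adjoint ZQ * C\<^sup>T)) @\<^sub>r (1\<^sub>m mm - mat_adjoint ZW * C\<^sup>T)) * X *
                   four_block_mat (- (C * ZQ)) (1\<^sub>m mm - C * ZW) (0\<^sub>m 0 dd) (0\<^sub>m 0 mm))
               (- complex_of_real \<epsilon> \<cdot>\<^sub>m 1\<^sub>m (dd + mm)))) \<longleftrightarrow>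
     (\<exists>\<epsilon>::real. \<epsilon> > 0 \<and>
       (\<forall>\<omega> \<in> {0..\<infinity>}.
          let M = lumped Gpq Gpw Gzq Gzw \<Gamma> \<omega> @\<^sub>r 1\<^sub>m dd
          in loewner_le dd (mat_adjoint M * at_freq \<Phi> \<omega> * M) (- complex_of_real \<epsilon> \<cdot>\<^sub>m 1\<^sub>m dd)))"
    unfolding Let_def Q_def R_def M_def S_def L_def PQ_def PW_def ZQ_def ZW_def C_def .
qed

end
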